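(* Let $R>0$, let $\overline{B}(0,R)=\{z\in\mathbb C:|z|\le R\}$, and let $f$ be a continuous function from $\overline{B}(0,R)$ into $\mathfrak F_{dist}(\mathbf 2)$. Let $C$ be a smooth path inside $\overline{B}(0,R)$ with continuously differentiable parametrization $\gamma(t)$, $t\in[a,b]$. Then the stochastic integral $$\int_C f(z)\star N_z\,dz=\int_a^b f(\gamma(t))\star N_{\gamma(t)}\,\gamma^\prime(t)\,dt$$ exists as the integral of a Hilbert space valued continuous function; that is, there is $p\in\mathbb N$ such that $t\mapsto f(\gamma(t))\star N_{\gamma(t)}\gamma^\prime(t)$ is a continuous function from $[a,b]$ into the Hilbert space $\mathcal F_{-p}$, and the integral exists as its Riemann integral in $\mathcal F_{-p}$.
   Context: Hermite functions: $H_n(z)=(-1)^ne^{z^2}(d/dz)^ne^{-z^2}$ and $\zeta_n(z)=\frac{1}{\pi^{1/4}2^{n/2}(n!)^{1/2}}(-1)^ne^{-z^2/2}H_n(z)$, $n=0,1,\ldots$; these are entire functions, orthonormal in $L_2(\mathbb R,dx)$. White noise space: $\mathscr S'_{\mathbb R}$ is the space of real tempered distributions on $\mathbb R$, $\mathcal C$ its cylinder sigma-algebra, and $P$ the probability measure (Bochner–Minlos) with $\int e^{i\langle s,\omega\rangle}dP(\omega)=e^{-\|s\|_2^2/2}$ for all real Schwartz functions $s$. $Z_n(\omega)=\langle\zeta_n,\omega\rangle$, $n=0,1,\ldots$, are independent $N(0,1)$ random variables. Let $\ell$ be the set of finitely supported sequences $\alpha=(\alpha_1,\alpha_2,\ldots)$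 of non-negative integers, with $\alpha!=\prod_k\alpha_k!$. The functions $H_\alpha=\prod_{k\ge1}h_{\alpha_k}(Z_{k-1})$, where $h_n(x)=(-1)^ne^{x^2/2}(d/dx)^ne^{-x^2/2}$, form an orthogonal basis of $\mathbf L_2(\mathscr S'_{\mathbb R},\mathcal C,P)$ with $\|H_\alpha\|^2=\alpha!$. Elements $\sum_\alpha f_\alpha H_\alpha$ are identified with their coefficient families $(f_\alpha)_{\alpha\in\ell}$; in particular $Z_n$ is identified with the family equal to $1$ at $\alpha^{(n)}$ and $0$ elsewhere, where $\alpha^{(n)}\in\ell$ has $1$ in position $n+1$ and $0$ elsewhere. Stochastic distributions: let $b_\alpha=\prod_{k\ge1}(2^k)^{\alpha_k}$. For $p=1,2,\ldots$, $\mathcal F_{-p}$ is the Hilbert space of complex families $(f_\alpha)_{\alpha\in\ell}$ with $\|f\|_{-p}^2=\sum_{\alpha\in\ell}|f_\alpha|^2b_\alpha^{-p}<\infty$, and $\mathfrak F_{dist}(\mathbf 2)=\bigcup_{p\ge1}\mathcal F_{-p}$ with the inductive limit topology. The Wick product, determined by $H_\alpha\star H_\beta=H_{\alpha+\beta}$, is the convolution of coefficients: $(f\star g)_\alpha=\sum_{\beta+\gamma=\alpha}f_\beta g_\gamma$ for $f,g\in\mathfrak F_{dist}(\mathbf 2)$; $\mathfrak F_{dist}(\mathbf 2)$ is an algebra under it. Complex white noise: for $z\in\mathbb C$, $N_z=\sum_{n=0}^\infty\zeta_n(z)Z_n$, i.e. the family with coefficient $\zeta_n(z)$ at $\alpha^{(n)}$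 ($n\ge0$) and $0$ at all other $\alpha\in\ell$. *)

theory Defs
  imports "HOL-Analysis.Analysis" "HOL-Library.Poly_Mapping"
begin

section \<open>Hermite functions\<close>

definition hermite_H :: "nat \<Rightarrow> complex \<Rightarrow> complex" where
  "hermite_H n z = (-1) ^ n * exp (z\<^sup>2) * (deriv ^^ n) (\<lambda>w. exp (- (w\<^sup>2))) z"

definition hermite_fun :: "nat \<Rightarrow> complex \<Rightarrow> complex" where
  "hermite_fun n z =
     of_real (1 / (pi powr (1/4) * 2 powr (real n / 2) * sqrt (fact n)))
       * (-1) ^ n * exp (- (z\<^sup>2) / 2) * hermite_H n z"

section \<open>Stochastic distributions as coefficient families\<close>

text \<open>A multi-index is a finitely supported function; position \<open>k \<ge> 1\<close> of a sequence
  \<open>(\<alpha>\<^sub>1, \<alpha>\<^sub>2, \<dots>)\<close> is the key \<open>k - 1\<close>.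
  An expansion \<open>\<Sum>\<^sub>\<alpha> f\<^sub>\<alpha> H\<^sub>\<alpha>\<close> is identified with its family of
  complex coefficients.\<close>

type_synonym multi_index = "nat \<Rightarrow>\<^sub>0 nat"
type_synonym family = "multi_index \<Rightarrow> complex"

text \<open>The exponent is \<open>k + 1\<close> because of the index shift.\<close>

definition weight :: "multi_index \<Rightarrow> real" where
  "weight \<alpha> = (\<Prod>k\<in>Poly_Mapping.keys \<alpha>. (2 ^ (k + 1)) ^ Poly_Mapping.lookup \<alpha> k)"

definition Fneg :: "nat \<Rightarrow> family set" where
  "Fneg p = {f. (\<lambda>\<alpha>. (cmod (f \<alpha>))\<^sup>2 / weight \<alpha> ^ p) summable_on UNIV}"

definition Fneg_norm :: "nat \<Rightarrow> family \<Rightarrow> real" where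
  "Fneg_norm p f = sqrt (\<Sum>\<^sub>\<infinity>\<alpha>. (cmod (f \<alpha>))\<^sup>2 / weight \<alpha> ^ p)"

definition Fneg_dist :: "nat \<Rightarrow> family \<Rightarrow> family \<Rightarrow> real" where
  "Fneg_dist p f g = Fneg_norm p (\<lambda>\<alpha>. f \<alpha> - g \<alpha>)"

definition Fneg_top :: "nat \<Rightarrow> family topology" where
  "Fneg_top p = Metric_space.mtopology (Fneg p) (Fneg_dist p)"

definition Fdist :: "family set" where
  "Fdist = (\<Union>p\<in>{1..}. Fneg p)"

text \<open>Locally convex inductive limit topology: a base of neighbourhoods of \<open>0\<close> consists of
  the absolutely convex sets whose trace on each step \<open>Fneg p\<close> is a neighbourhood of \<open>0\<close>
  there (such sets are automatically absorbing).\<close>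

definition Fdist_nbhd0 :: "family set \<Rightarrow> bool" where
  "Fdist_nbhd0 U \<longleftrightarrow> U \<subseteq> Fdist
     \<and> (\<forall>f\<in>U. \<forall>g\<in>U. \<forall>a b :: complex. cmod a + cmod b \<le> 1 \<longrightarrow> (\<lambda>\<alpha>. a * f \<alpha> + b * g \<alpha>) \<in> U)
     \<and> (\<forall>p\<ge>1. \<exists>r>0. {f \<in> Fneg p. Fneg_norm p f < r} \<subseteq> U)"

definition Fdist_open :: "family set \<Rightarrow> bool" where
  "Fdist_open V \<longleftrightarrow> V \<subseteq> Fdist
     \<and> (\<forall>f\<in>V. \<exists>U. Fdist_nbhd0 U \<and> (\<forall>g\<in>U. (\<lambda>\<alpha>. f \<alpha> + g \<alpha>) \<in> V))"

definition Fdist_top :: "family topology" where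
  "Fdist_top = topology Fdist_open"

definition wick :: "family \<Rightarrow> family \<Rightarrow> family" (infixl "\<star>" 70) where
  "(f \<star> g) \<alpha> = (\<Sum>(\<beta>, \<gamma>) \<in> {(\<beta>, \<gamma>). \<beta> + \<gamma> = \<alpha>}. f \<beta> * g \<gamma>)"

definition Zfam :: "nat \<Rightarrow> family" where
  "Zfam n \<alpha> = (if \<alpha> = Poly_Mapping.single n 1 then 1 else 0)"

text \<open>For each \<open>\<alpha>\<close> at most one term of the series is nonzero.\<close>

definition white_noise :: "complex \<Rightarrow> family" where
  "white_noise z \<alpha> = suminf (\<lambda>n. hermite_fun n z * Zfam n \<alpha>)"

text \<open>Riemann integrability on \<open>[a, b]\<close> in the sense of tagged partitions whose mesh tends
  to \<open>0\<close>, with convergence of the Riemann sums in \<open>Fneg p\<close>.\<close>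

definition has_Riemann_integral_Fneg ::
  "nat \<Rightarrow> (real \<Rightarrow> family) \<Rightarrow> family \<Rightarrow> real \<Rightarrow> real \<Rightarrow> bool" where
  "has_Riemann_integral_Fneg p g I a b \<longleftrightarrow>
     g ` {a..b} \<subseteq> Fneg p \<and> I \<in> Fneg p \<and>
     (\<forall>\<epsilon>>0. \<exists>\<delta>>0. \<forall>D. D tagged_division_of {a..b} \<and> (\<forall>(t, K)\<in>D. measure lborel K < \<delta>) \<longrightarrow>
        Fneg_dist p (\<lambda>\<alpha>. \<Sum>(t, K)\<in>D. of_real (measure lborel K) * g t \<alpha>) I < \<epsilon>)"

section \<open>The topologies and finite sums above are the intended ones\<close>

lemma weight_pos: "weight \<alpha> > 0"
  unfolding weight_def by (rule prod_pos) simp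

lemma Fneg_lincomb:
  assumes "f \<in> Fneg p" "g \<in> Fneg p"
  shows "(\<lambda>\<alpha>. a * f \<alpha> + b * g \<alpha>) \<in> Fneg p"
proof -
  have "(\<lambda>\<alpha>. 2 * (cmod a)\<^sup>2 * ((cmod (f \<alpha>))\<^sup>2 / weight \<alpha> ^ p)
           + 2 * (cmod b)\<^sup>2 * ((cmod (g \<alpha>))\<^sup>2 / weight \<alpha> ^ p)) summable_on UNIV"
    using assms unfolding Fneg_def by (intro summable_on_add summable_on_cmult_right) auto
  then show ?thesis
    unfolding Fneg_def mem_Collect_eq
  proof (rule summable_on_comparison_test)
    fix \<alpha>
    have "(cmod (a * f \<alpha> + b * g \<alpha>))\<^sup>2 \<le> (cmod a * cmod (f \<alpha>) + cmod b * cmod (g \<alpha>))\<^sup>2"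
      by (intro power_mono) (metis norm_mult norm_triangle_ineq, simp)
    also have "\<dots> \<le> 2 * (cmod a)\<^sup>2 * (cmod (f \<alpha>))\<^sup>2 + 2 * (cmod b)\<^sup>2 * (cmod (g \<alpha>))\<^sup>2"
      using sum_squares_bound[of "cmod a * cmod (f \<alpha>)" "cmod b * cmod (g \<alpha>)"]
      by (simp add: power2_sum power_mult_distrib)
    finally have "(cmod (a * f \<alpha> + b * g \<alpha>))\<^sup>2 / weight \<alpha> ^ p
        \<le> (2 * (cmod a)\<^sup>2 * (cmod (f \<alpha>))\<^sup>2 + 2 * (cmod b)\<^sup>2 * (cmod (g \<alpha>))\<^sup>2) / weight \<alpha> ^ p"
      using weight_pos[of \<alpha>] by (intro divide_right_mono) auto
    then show "(cmod (a * f \<alpha> + b * g \<alpha>))\<^sup>2 / weight \<alpha> ^ p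
        \<le> 2 * (cmod a)\<^sup>2 * ((cmod (f \<alpha>))\<^sup>2 / weight \<alpha> ^ p)
           + 2 * (cmod b)\<^sup>2 * ((cmod (g \<alpha>))\<^sup>2 / weight \<alpha> ^ p)"
      by (simp add: add_divide_distrib)
  qed (use weight_pos in \<open>auto intro!: divide_nonneg_nonneg simp: less_imp_le\<close>)
qed

lemma Fneg_diff:
  assumes "f \<in> Fneg p" "g \<in> Fneg p"
  shows "(\<lambda>\<alpha>. f \<alpha> - g \<alpha>) \<in> Fneg p"
  using Fneg_lincomb[OF assms, of 1 "-1"] by simp

lemma L2_set_le_Fneg_norm:
  assumes "f \<in> Fneg p" "finite A"
  shows "L2_set (\<lambda>\<alpha>. cmod (f \<alpha>) / sqrt (weight \<alpha> ^ p)) A \<le> Fneg_norm p f"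
proof -
  have "(\<Sum>\<alpha>\<in>A. (cmod (f \<alpha>))\<^sup>2 / weight \<alpha> ^ p) \<le> (\<Sum>\<^sub>\<infinity>\<alpha>. (cmod (f \<alpha>))\<^sup>2 / weight \<alpha> ^ p)"
    using assms weight_pos unfolding Fneg_def
    by (intro finite_sum_le_infsum) (auto intro!: divide_nonneg_nonneg simp: less_imp_le)
  then show ?thesis
    using weight_pos unfolding L2_set_def Fneg_norm_def
    by (simp add: power_divide less_imp_le)
qed

lemma Fneg_norm_le:
  assumes "f \<in> Fneg p" "0 \<le> c"
    and "\<And>A. finite A \<Longrightarrow> L2_set (\<lambda>\<alpha>. cmod (f \<alpha>) / sqrt (weight \<alpha> ^ p)) A \<le> c"
  shows "Fneg_norm p f \<le> c"
proof -
  have "(\<Sum>\<^sub>\<infinity>\<alpha>. (cmod (f \<alpha>))\<^sup>2 / weight \<alpha> ^ p) \<le> c\<^sup>2"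
  proof (rule infsum_le_finite_sums)
    fix A :: "multi_index set" assume "finite A"
    from assms(3)[OF this] have "sqrt (\<Sum>\<alpha>\<in>A. (cmod (f \<alpha>))\<^sup>2 / weight \<alpha> ^ p) \<le> c"
      using weight_pos unfolding L2_set_def by (simp add: power_divide less_imp_le)
    then show "(\<Sum>\<alpha>\<in>A. (cmod (f \<alpha>))\<^sup>2 / weight \<alpha> ^ p) \<le> c\<^sup>2"
      using sqrt_le_D by blast
  qed (use assms(1) in \<open>simp add: Fneg_def\<close>)
  then show ?thesis
    unfolding Fneg_norm_def using assms(2) by (simp add: real_le_lsqrt)
qed

lemma Fneg_norm_nonneg: "0 \<le> Fneg_norm p f"
  unfolding Fneg_norm_def using weight_pos
  by (auto intro!: infsum_nonneg divide_nonneg_nonneg simp: less_imp_le)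

lemma Metric_space_Fneg: "Metric_space (Fneg p) (Fneg_dist p)"
proof
  fix f g h
  show "0 \<le> Fneg_dist p f g"
    by (simp add: Fneg_dist_def Fneg_norm_nonneg)
  show "Fneg_dist p f g = Fneg_dist p g f"
    by (simp add: Fneg_dist_def Fneg_norm_def norm_minus_commute)
  assume f: "f \<in> Fneg p" and g: "g \<in> Fneg p"
  note fg = Fneg_diff[OF f g]
  show "Fneg_dist p f g = 0 \<longleftrightarrow> f = g"
  proof
    assume 0: "Fneg_dist p f g = 0"
    show "f = g"
    proof
      fix \<alpha>
      have "cmod (f \<alpha> - g \<alpha>) / sqrt (weight \<alpha> ^ p) \<le> 0"
        using L2_set_le_Fneg_norm[OF fg, of "{\<alpha>}"] 0 weight_pos[of \<alpha>]
        by (auto simp: Fneg_dist_def L2_set_def)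
      then show "f \<alpha> = g \<alpha>"
        using zero_less_power[OF weight_pos[of \<alpha>], of p] by (auto simp: divide_le_0_iff)
    qed
  qed (simp add: Fneg_dist_def Fneg_norm_def)
  assume h: "h \<in> Fneg p"
  note gh = Fneg_diff[OF g h]
  have "Fneg_norm p (\<lambda>\<alpha>. f \<alpha> - h \<alpha>)
      \<le> Fneg_norm p (\<lambda>\<alpha>. f \<alpha> - g \<alpha>) + Fneg_norm p (\<lambda>\<alpha>. g \<alpha> - h \<alpha>)"
  proof (rule Fneg_norm_le[OF Fneg_diff[OF f h]])
    fix A :: "multi_index set" assume A: "finite A"
    have "L2_set (\<lambda>\<alpha>. cmod (f \<alpha> - h \<alpha>) / sqrt (weight \<alpha> ^ p)) A
        \<le> L2_set (\<lambda>\<alpha>. cmod (f \<alpha> - g \<alpha>) / sqrt (weight \<alpha> ^ p)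
                       + cmod (g \<alpha> - h \<alpha>) / sqrt (weight \<alpha> ^ p)) A"
    proof (rule L2_set_mono)
      fix \<alpha>
      have "cmod (f \<alpha> - h \<alpha>) \<le> cmod (f \<alpha> - g \<alpha>) + cmod (g \<alpha> - h \<alpha>)"
        using norm_triangle_ineq[of "f \<alpha> - g \<alpha>" "g \<alpha> - h \<alpha>"] by simp
      then show "cmod (f \<alpha> - h \<alpha>) / sqrt (weight \<alpha> ^ p)
          \<le> cmod (f \<alpha> - g \<alpha>) / sqrt (weight \<alpha> ^ p) + cmod (g \<alpha> - h \<alpha>) / sqrt (weight \<alpha> ^ p)"
        using weight_pos[of \<alpha>] by (simp add: divide_right_mono flip: add_divide_distrib)
    qed (use weight_pos in \<open>simp add: less_imp_le\<close>)
    also have "\<dots> \<le> L2_set (\<lambda>\<alpha>. cmod (f \<alpha> - g \<alpha>) / sqrt (weight \<alpha> ^ p)) A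
                   + L2_set (\<lambda>\<alpha>. cmod (g \<alpha> - h \<alpha>) / sqrt (weight \<alpha> ^ p)) A"
      by (rule L2_set_triangle_ineq)
    also have "\<dots> \<le> Fneg_norm p (\<lambda>\<alpha>. f \<alpha> - g \<alpha>) + Fneg_norm p (\<lambda>\<alpha>. g \<alpha> - h \<alpha>)"
      by (intro add_mono L2_set_le_Fneg_norm fg gh A)
    finally show "L2_set (\<lambda>\<alpha>. cmod (f \<alpha> - h \<alpha>) / sqrt (weight \<alpha> ^ p)) A \<le> \<dots>" .
  qed (simp add: Fneg_norm_nonneg)
  then show "Fneg_dist p f h \<le> Fneg_dist p f g + Fneg_dist p g h"
    by (simp add: Fneg_dist_def)
qed

lemma topspace_Fneg_top [simp]: "topspace (Fneg_top p) = Fneg p"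
  unfolding Fneg_top_def by (rule Metric_space.topspace_mtopology[OF Metric_space_Fneg])

lemma Fdist_nbhd0_Int:
  assumes "Fdist_nbhd0 U" "Fdist_nbhd0 U'"
  shows "Fdist_nbhd0 (U \<inter> U')"
  unfolding Fdist_nbhd0_def
proof (intro conjI allI impI)
  fix p :: nat assume "1 \<le> p"
  then obtain r r' where "r > 0" "{f \<in> Fneg p. Fneg_norm p f < r} \<subseteq> U"
    and "r' > 0" "{f \<in> Fneg p. Fneg_norm p f < r'} \<subseteq> U'"
    using assms unfolding Fdist_nbhd0_def by meson
  then show "\<exists>r>0. {f \<in> Fneg p. Fneg_norm p f < r} \<subseteq> U \<inter> U'"
    by (intro exI[of _ "min r r'"]) auto
qed (use assms in \<open>auto simp: Fdist_nbhd0_def\<close>)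

lemma istopology_Fdist_open: "istopology Fdist_open"
  unfolding istopology_def
proof (intro conjI allI impI)
  fix S T assume S: "Fdist_open S" and T: "Fdist_open T"
  show "Fdist_open (S \<inter> T)"
    unfolding Fdist_open_def
  proof (intro conjI ballI)
    fix f assume "f \<in> S \<inter> T"
    then obtain U U' where "Fdist_nbhd0 U" "\<forall>g\<in>U. (\<lambda>\<alpha>. f \<alpha> + g \<alpha>) \<in> S"
      and "Fdist_nbhd0 U'" "\<forall>g\<in>U'. (\<lambda>\<alpha>. f \<alpha> + g \<alpha>) \<in> T"
      using S T unfolding Fdist_open_def by blast
    then show "\<exists>U. Fdist_nbhd0 U \<and> (\<forall>g\<in>U. (\<lambda>\<alpha>. f \<alpha> + g \<alpha>) \<in> S \<inter> T)"
      by (intro exI[of _ "U \<inter> U'"]) (auto simp: Fdist_nbhd0_Int)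
  qed (use S in \<open>auto simp: Fdist_open_def\<close>)
next
  fix \<K> assume *: "\<forall>K\<in>\<K>. Fdist_open K"
  show "Fdist_open (\<Union>\<K>)"
    unfolding Fdist_open_def
  proof (intro conjI ballI)
    fix f assume "f \<in> \<Union>\<K>"
    then obtain K where K: "K \<in> \<K>" "f \<in> K" by blast
    with * obtain U where "Fdist_nbhd0 U" "\<forall>g\<in>U. (\<lambda>\<alpha>. f \<alpha> + g \<alpha>) \<in> K"
      unfolding Fdist_open_def by blast
    with K show "\<exists>U. Fdist_nbhd0 U \<and> (\<forall>g\<in>U. (\<lambda>\<alpha>. f \<alpha> + g \<alpha>) \<in> \<Union>\<K>)" by blast
  qed (use * in \<open>auto simp: Fdist_open_def\<close>)
qed

lemma openin_Fdist_top: "openin Fdist_top V \<longleftrightarrow> Fdist_open V"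
  by (simp add: Fdist_top_def istopology_Fdist_open)

lemma Fneg_Suc: "Fneg p \<subseteq> Fneg (Suc p)"
proof
  fix f assume "f \<in> Fneg p"
  then have "(\<lambda>\<alpha>. (cmod (f \<alpha>))\<^sup>2 / weight \<alpha> ^ p) summable_on UNIV" by (simp add: Fneg_def)
  then have "(\<lambda>\<alpha>. (cmod (f \<alpha>))\<^sup>2 / weight \<alpha> ^ Suc p) summable_on UNIV"
  proof (rule summable_on_comparison_test)
    fix \<alpha>
    have "1 \<le> weight \<alpha>" unfolding weight_def by (intro prod_ge_1 one_le_power) simp
    then have "weight \<alpha> ^ p \<le> weight \<alpha> ^ Suc p" by (intro power_increasing) auto
    then show "(cmod (f \<alpha>))\<^sup>2 / weight \<alpha> ^ Suc p \<le> (cmod (f \<alpha>))\<^sup>2 / weight \<alpha> ^ p"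
      using weight_pos[of \<alpha>] by (intro divide_left_mono) auto
  qed (use weight_pos in \<open>auto intro!: divide_nonneg_nonneg simp: less_imp_le\<close>)
  then show "f \<in> Fneg (Suc p)" by (simp add: Fneg_def)
qed

lemma Fneg_mono: "p \<le> q \<Longrightarrow> Fneg p \<subseteq> Fneg q"
  by (rule lift_Suc_mono_le[of Fneg]) (use Fneg_Suc in auto)

lemma Fdist_lincomb:
  assumes "f \<in> Fdist" "g \<in> Fdist"
  shows "(\<lambda>\<alpha>. a * f \<alpha> + b * g \<alpha>) \<in> Fdist"
proof -
  from assms obtain p q where "1 \<le> p" "f \<in> Fneg p" "1 \<le> q" "g \<in> Fneg q"
    unfolding Fdist_def by auto
  then have "f \<in> Fneg (max p q)" "g \<in> Fneg (max p q)" "1 \<le> max p q"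
    using Fneg_mono[of p "max p q"] Fneg_mono[of q "max p q"] by auto
  then show ?thesis
    unfolding Fdist_def using Fneg_lincomb[of f "max p q" g a b]
    by (intro UN_I[of "max p q"]) auto
qed

lemma topspace_Fdist_top [simp]: "topspace Fdist_top = Fdist"
proof -
  have "Fdist_nbhd0 Fdist"
    unfolding Fdist_nbhd0_def using Fdist_lincomb
    by (auto simp: Fdist_def intro: exI[of _ "1::real"])
  then have "Fdist_open Fdist"
    unfolding Fdist_open_def using Fdist_lincomb[of _ _ 1 1] by auto
  then show ?thesis
    by (metis Fdist_open_def openin_Fdist_top openin_subset openin_topspace subset_antisym)
qed

lemma continuous_map_Fneg_Fdist:
  assumes "1 \<le> p"
  shows "continuous_map (Fneg_top p) Fdist_top (\<lambda>f. f)"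
  unfolding continuous_map_def
proof (intro conjI allI impI)
  show "(\<lambda>f. f) \<in> topspace (Fneg_top p) \<rightarrow> topspace Fdist_top"
    using assms by (auto simp: Fdist_def)
  fix V assume "openin Fdist_top V"
  then have V: "Fdist_open V" by (simp add: openin_Fdist_top)
  interpret Metric_space "Fneg p" "Fneg_dist p" by (rule Metric_space_Fneg)
  have "openin mtopology {f \<in> Fneg p. f \<in> V}"
    unfolding openin_mtopology
  proof (intro conjI allI impI)
    fix f assume f: "f \<in> {f \<in> Fneg p. f \<in> V}"
    then obtain U where U: "Fdist_nbhd0 U" "\<forall>g\<in>U. (\<lambda>\<alpha>. f \<alpha> + g \<alpha>) \<in> V"
      using V unfolding Fdist_open_def by blast
    from U(1) obtain r where r: "r > 0" "{f \<in> Fneg p. Fneg_norm p f < r} \<subseteq> U"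
      using assms unfolding Fdist_nbhd0_def by meson
    have "mball f r \<subseteq> {f \<in> Fneg p. f \<in> V}"
    proof
      fix g assume g: "g \<in> mball f r"
      then have "Fneg_norm p (\<lambda>\<alpha>. g \<alpha> - f \<alpha>) < r"
        using commute[of f g] by (simp add: Fneg_dist_def)
      then have "(\<lambda>\<alpha>. g \<alpha> - f \<alpha>) \<in> U" using r(2) g Fneg_diff[of g p f] by auto
      from bspec[OF U(2) this] have "(\<lambda>\<alpha>. f \<alpha> + (g \<alpha> - f \<alpha>)) \<in> V" .
      with g show "g \<in> {f \<in> Fneg p. f \<in> V}" by simp
    qed
    with r(1) show "\<exists>r>0. mball f r \<subseteq> {f \<in> Fneg p. f \<in> V}" by blast
  qed auto
  then show "openin (Fneg_top p) {f \<in> topspace (Fneg_top p). f \<in> V}"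
    by (simp add: Fneg_top_def)
qed

lemma finite_decompositions: "finite {(\<beta>, \<gamma>). \<beta> + \<gamma> = (\<alpha> :: multi_index)}"
proof -
  let ?K = "Poly_Mapping.keys \<alpha>"
  have fin: "finite {h. \<forall>k. (k \<in> ?K \<longrightarrow> h k \<in> {..Max (insert 0 (Poly_Mapping.lookup \<alpha> ` ?K))})
      \<and> (k \<notin> ?K \<longrightarrow> h k = (0::nat))}"
    by (rule finite_set_of_finite_funs) auto
  define S where "S = {\<beta> :: multi_index. \<exists>\<gamma>. \<beta> + \<gamma> = \<alpha>}"
  have "Poly_Mapping.lookup ` S \<subseteq> {h. \<forall>k. (k \<in> ?K \<longrightarrow>
      h k \<in> {..Max (insert 0 (Poly_Mapping.lookup \<alpha> ` ?K))}) \<and> (k \<notin> ?K \<longrightarrow> h k = (0::nat))}"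
  proof (clarsimp simp: S_def, intro conjI impI)
    fix \<beta> \<gamma> :: multi_index and k
    assume \<alpha>: "\<alpha> = \<beta> + \<gamma>"
    show "Poly_Mapping.lookup \<beta> k \<le>
        Max (insert 0 (Poly_Mapping.lookup (\<beta> + \<gamma>) ` Poly_Mapping.keys (\<beta> + \<gamma>)))"
      if "k \<in> Poly_Mapping.keys (\<beta> + \<gamma>)"
    proof -
      have "Poly_Mapping.lookup \<beta> k \<le> Poly_Mapping.lookup (\<beta> + \<gamma>) k" by (simp add: lookup_add)
      also have "\<dots> \<le> Max (insert 0 (Poly_Mapping.lookup (\<beta> + \<gamma>) ` Poly_Mapping.keys (\<beta> + \<gamma>)))"
        using that by (intro Max_ge) auto
      finally show ?thesis .
    qed
    show "Poly_Mapping.lookup \<beta> k = 0" if "k \<notin> Poly_Mapping.keys (\<beta> + \<gamma>)"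
      using that by (simp add: in_keys_iff lookup_add)
  qed
  then have "finite (Poly_Mapping.lookup ` S)" using fin by (rule finite_subset)
  then have S: "finite S"
    by (rule finite_imageD) (rule inj_onI, simp add: poly_mapping.lookup_inject)
  have "\<beta> \<in> S \<and> \<gamma> \<in> S" if "\<beta> + \<gamma> = \<alpha>" for \<beta> \<gamma>
    using that trans[OF add.commute[of \<gamma> \<beta>] that] unfolding S_def by blast
  then have "{(\<beta>, \<gamma>). \<beta> + \<gamma> = \<alpha>} \<subseteq> S \<times> S" by blast
  then show ?thesis by (rule finite_subset) (simp add: S)
qed

lemma white_noise_single: "white_noise z (Poly_Mapping.single n 1) = hermite_fun n z"
proof -
  have "hermite_fun m z * Zfam m (Poly_Mapping.single n 1) = (if m = n then hermite_fun n z else 0)"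
    for m
    by (auto simp: Zfam_def poly_mapping_eq_iff fun_eq_iff lookup_single when_def)
  then show ?thesis
    unfolding white_noise_def using sums_single[of n "\<lambda>_. hermite_fun n z"]
    by (simp add: sums_iff eq_commute)
qed

lemma white_noise_eq_0: "(\<And>n. \<alpha> \<noteq> Poly_Mapping.single n 1) \<Longrightarrow> white_noise z \<alpha> = 0"
  by (simp add: white_noise_def Zfam_def)

end

theory Submission
  imports Defs "HOL-Complex_Analysis.Cauchy_Integral_Formula"
begin

text \<open>Write \<open>b\<^sub>\<alpha>\<close> for the weight. A continuous map from a compact set into the inductive limit satisfies
  one uniform bound \<open>\<bar>f\<^sub>\<alpha>\<bar> \<le> C b\<^sub>\<alpha>\<^sup>q\<close>, and Cauchy's inequality gives
  \<open>\<bar>\<zeta>\<^sub>n(z)\<bar> \<le> C' 16\<^sup>n\<close> for \<open>\<bar>z\<bar> \<le> R\<close>, which is a bound of the same kind for the white noise.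
  Since \<open>\<Sum>\<^sub>\<alpha> 1 / b\<^sub>\<alpha>\<close> converges, the coefficients of the Wick product are also bounded
  by a multiple of a power of \<open>b\<^sub>\<alpha>\<close>, uniformly in \<open>t\<close>, and each of them is a continuous function
  of \<open>t\<close>. In \<open>Fneg p\<close> with \<open>p\<close> large, continuity and convergence of the Riemann sums
  then follow by dominated convergence over the multi-indices.\<close>

subsection \<open>Weights\<close>

lemma weight_ge_1: "1 \<le> weight \<alpha>"
  unfolding weight_def by (intro prod_ge_1 one_le_power) simp

text \<open>Indices outside the keys have exponent 0 and contribute factors 1. This puts several
  weights over one common index set.\<close>

lemma weight_eq_prod:
  assumes "finite A" "Poly_Mapping.keys \<alpha> \<subseteq> A"
  shows "weight \<alpha> = (\<Prod>k\<in>A. (2 ^ (k + 1)) ^ Poly_Mapping.lookup \<alpha> k)"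
  unfolding weight_def
  by (rule prod.mono_neutral_left) (use assms in \<open>auto simp: in_keys_iff\<close>)

lemma weight_add: "weight (\<alpha> + \<beta>) = weight \<alpha> * weight \<beta>"
proof -
  let ?A = "Poly_Mapping.keys \<alpha> \<union> Poly_Mapping.keys \<beta>"
  have "weight (\<alpha> + \<beta>) = (\<Prod>k\<in>?A. (2 ^ (k + 1)) ^ Poly_Mapping.lookup (\<alpha> + \<beta>) k)"
    by (rule weight_eq_prod) (simp, rule Poly_Mapping.keys_add)
  also have "\<dots> = (\<Prod>k\<in>?A. (2 ^ (k + 1)) ^ Poly_Mapping.lookup \<alpha> k)
      * (\<Prod>k\<in>?A. (2 ^ (k + 1)) ^ Poly_Mapping.lookup \<beta> k)"
    by (simp add: lookup_add power_add prod.distrib)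
  also have "\<dots> = weight \<alpha> * weight \<beta>"
    by (simp add: weight_eq_prod[of ?A])
  finally show ?thesis .
qed

lemma weight_single: "weight (Poly_Mapping.single n 1) = 2 ^ (n + 1)"
  by (simp add: weight_def)

text \<open>Formally, the sum of \<open>1 / weight \<alpha>\<close> over all multi-indices factors
  into geometric series with ratios \<open>2 ^ -(k + 1)\<close>. A finite \<open>F\<close> sits
  inside a box of exponents, where the factorization is a finite identity. The k-th factor is at
  most \<open>exp (2 * x k)\<close>, and the ratios add up to at most 1.\<close>

lemma sum_inverse_weight_le:
  assumes "finite F"
  shows "(\<Sum>\<alpha>\<in>F. 1 / weight \<alpha>) \<le> exp 2"
proof -
  define S where "S = (\<Union>\<alpha>\<in>F. Poly_Mapping.keys \<alpha>)"
  have "finite S" using assms by (simp add: S_def)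
  then obtain n where n: "S \<subseteq> {..<n}" using finite_nat_iff_bounded by blast
  define L where "L = (\<Union>\<alpha>\<in>F. Poly_Mapping.lookup \<alpha> ` {..<n})"
  have "finite L" using assms by (simp add: L_def)
  then obtain m where m: "L \<subseteq> {..<m}" using finite_nat_iff_bounded by blast
  define x where "x = (\<lambda>k. (1 / 2) ^ (k + 1) :: real)"
  \<comment> \<open>Restriction turns a multi-index into an extensional function, so that
    \<open>F\<close> becomes a subset of a \<open>PiE\<close> box. No information is lost because
    all keys lie below \<open>n\<close>.\<close>
  define r where "r = (\<lambda>\<alpha>::multi_index. restrict (Poly_Mapping.lookup \<alpha>) {..<n})"
  have keys: "Poly_Mapping.keys \<alpha> \<subseteq> {..<n}" if "\<alpha> \<in> F" for \<alpha>
    using n that by (auto simp: S_def)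
  have inj: "inj_on r F"
  proof (rule inj_onI)
    fix \<alpha> \<beta> assume *: "\<alpha> \<in> F" "\<beta> \<in> F" "r \<alpha> = r \<beta>"
    show "\<alpha> = \<beta>"
    proof (rule poly_mapping_eqI)
      fix k
      show "Poly_Mapping.lookup \<alpha> k = Poly_Mapping.lookup \<beta> k"
      proof (cases "k < n")
        case True
        then show ?thesis using fun_cong[OF *(3), of k] by (simp add: r_def)
      next
        case False
        then have "k \<notin> Poly_Mapping.keys \<alpha>" "k \<notin> Poly_Mapping.keys \<beta>"
          using keys[OF *(1)] keys[OF *(2)] by auto
        then show ?thesis by (simp add: in_keys_iff)
      qed
    qed
  qed
  have "(\<Sum>\<alpha>\<in>F. 1 / weight \<alpha>) = (\<Sum>\<alpha>\<in>F. \<Prod>k<n. x k ^ r \<alpha> k)"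
  proof (rule sum.cong[OF refl])
    fix \<alpha> assume "\<alpha> \<in> F"
    then have "weight \<alpha> = (\<Prod>k<n. (2 ^ (k + 1)) ^ Poly_Mapping.lookup \<alpha> k)"
      using keys by (intro weight_eq_prod) auto
    then have "1 / weight \<alpha> = (\<Prod>k<n. 1 / (2 ^ (k + 1)) ^ Poly_Mapping.lookup \<alpha> k)"
      by (simp add: prod_dividef)
    also have "\<dots> = (\<Prod>k<n. x k ^ r \<alpha> k)"
      by (rule prod.cong) (auto simp: x_def r_def power_divide simp del: power_Suc)
    finally show "1 / weight \<alpha> = (\<Prod>k<n. x k ^ r \<alpha> k)" .
  qed
  also have "\<dots> = (\<Sum>g\<in>r ` F. \<Prod>k<n. x k ^ g k)"
    by (simp add: sum.reindex[OF inj])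
  \<comment> \<open>Enlarging to the full box lets the sum of products become a product of
    sums.\<close>
  also have "\<dots> \<le> (\<Sum>g\<in>PiE {..<n} (\<lambda>_. {..<m}). \<Prod>k<n. x k ^ g k)"
  proof (rule sum_mono2)
    show "r ` F \<subseteq> PiE {..<n} (\<lambda>_. {..<m})"
      using m by (fastforce simp: r_def L_def)
  qed (auto intro!: finite_PiE prod_nonneg simp: x_def)
  also have "\<dots> = (\<Prod>k<n. \<Sum>j<m. x k ^ j)"
    by (rule prod_sum_PiE[symmetric]) auto
  also have "\<dots> \<le> (\<Prod>k<n. exp (2 * x k))"
  proof (rule prod_mono)
    fix k
    have "(1 / 2) ^ k \<le> (1 :: real)" by (rule power_le_one) auto
    then have x: "0 < x k" "x k \<le> 1 / 2" unfolding x_def by auto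
    have "(\<Sum>j<m. x k ^ j) = (1 - x k ^ m) / (1 - x k)"
      using x by (subst sum_gp_strict) auto
    also have "\<dots> \<le> 1 / (1 - x k)"
      using x by (intro divide_right_mono) auto
    \<comment> \<open>This needs \<open>x k \<le> 1 / 2\<close>, with equality at
      \<open>k = 0\<close>; the smallest base of the weights is 2.\<close>
    also have "\<dots> \<le> 1 + 2 * x k"
    proof -
      have "0 \<le> x k * (1 - 2 * x k)" using x by simp
      then have "1 \<le> (1 + 2 * x k) * (1 - x k)" by (simp add: algebra_simps)
      then show ?thesis using x by (simp add: pos_divide_le_eq)
    qed
    also have "\<dots> \<le> exp (2 * x k)" by simp
    finally show "0 \<le> (\<Sum>j<m. x k ^ j) \<and> (\<Sum>j<m. x k ^ j) \<le> exp (2 * x k)"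
      using x by (simp add: sum_nonneg)
  qed
  also have "\<dots> = exp (2 * (\<Sum>k<n. x k))"
    by (simp add: exp_sum sum_distrib_left)
  also have "(\<Sum>k<n. x k) \<le> 1"
  proof -
    have "(\<Sum>k<n. x k) = 1 - (1 / 2) ^ n"
      by (induction n) (auto simp: x_def)
    then show ?thesis by simp
  qed
  finally show ?thesis by simp
qed

lemma summable_inverse_weight: "(\<lambda>\<alpha>. 1 / weight \<alpha>) summable_on UNIV"
  by (rule nonneg_bdd_above_summable_on)
    (use weight_pos sum_inverse_weight_le in \<open>auto intro!: bdd_aboveI2 simp: less_imp_le\<close>)

subsection \<open>Dominated convergence and Riemann integrals in the spaces of coefficients\<close>

lemma Fneg_dominated:
  assumes "(\<lambda>\<alpha>. (B \<alpha>)\<^sup>2 / weight \<alpha> ^ p) summable_on UNIV"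
    and "\<And>\<alpha>. cmod (h \<alpha>) \<le> B \<alpha>"
  shows "h \<in> Fneg p"
  unfolding Fneg_def mem_Collect_eq
  by (rule summable_on_comparison_test[OF assms(1)])
    (use assms(2) weight_pos in
      \<open>auto intro!: divide_right_mono power_mono divide_nonneg_nonneg simp: less_imp_le\<close>)

text \<open>An epsilon form of dominated convergence. Outside a finite \<open>F\<close> the tail of
  the summable majorant is small; on \<open>F\<close> small coordinates suffice, since dividing by a
  weight at least 1 only helps. \<open>F\<close> and \<open>\<eta>\<close> are chosen before
  \<open>h\<close>, which makes the estimate uniform.\<close>

lemma Fneg_norm_dominated_small:
  assumes B: "(\<lambda>\<alpha>. (B \<alpha>)\<^sup>2 / weight \<alpha> ^ p) summable_on UNIV" and "\<epsilon> > 0"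
  shows "\<exists>F \<eta>. finite F \<and> \<eta> > 0 \<and>
    (\<forall>h. (\<forall>\<alpha>. cmod (h \<alpha>) \<le> B \<alpha>) \<longrightarrow> (\<forall>\<alpha>\<in>F. cmod (h \<alpha>) \<le> \<eta>)
      \<longrightarrow> Fneg_norm p h < \<epsilon>)"
proof -
  let ?M = "\<lambda>\<alpha>. (B \<alpha>)\<^sup>2 / weight \<alpha> ^ p"
  have M0: "0 \<le> ?M \<alpha>" for \<alpha> using weight_pos[of \<alpha>] by (simp add: less_imp_le)
  have w1: "1 \<le> weight \<alpha> ^ p" for \<alpha> by (rule one_le_power[OF weight_ge_1])
  have "\<epsilon>\<^sup>2 / 4 > 0" using \<open>\<epsilon> > 0\<close> by simp
  from infsum_finite_approximation[OF B this] obtain F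
    where F: "finite F" "dist (sum ?M F) (infsum ?M UNIV) \<le> \<epsilon>\<^sup>2 / 4" by blast
  \<comment> \<open>With this value the coordinates in \<open>F\<close> contribute at most
    \<open>\<epsilon>\<^sup>2 / 4\<close>, as much as the tail. Adding 1 to the cardinality covers
    an empty \<open>F\<close>.\<close>
  define \<eta> where "\<eta> = sqrt (\<epsilon>\<^sup>2 / (4 * (card F + 1)))"
  have \<eta>: "\<eta> > 0" using \<open>\<epsilon> > 0\<close> by (simp add: \<eta>_def)
  have \<eta>2: "\<eta>\<^sup>2 = \<epsilon>\<^sup>2 / (4 * (card F + 1))" unfolding \<eta>_def by (rule real_sqrt_pow2) simp
  have \<eta>F: "card F * \<eta>\<^sup>2 \<le> \<epsilon>\<^sup>2 / 4"
  proof -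
    have "card F * \<epsilon>\<^sup>2 \<le> (card F + 1) * \<epsilon>\<^sup>2" by (intro mult_right_mono) auto
    then show ?thesis unfolding \<eta>2 by (simp add: field_simps)
  qed
  show ?thesis
  proof (intro exI[of _ F] exI[of _ \<eta>] conjI F(1) \<eta> allI impI)
    fix h assume "\<forall>\<alpha>. cmod (h \<alpha>) \<le> B \<alpha>" and "\<forall>\<alpha>\<in>F. cmod (h \<alpha>) \<le> \<eta>"
    then have hB: "\<And>\<alpha>. cmod (h \<alpha>) \<le> B \<alpha>" and h\<eta>: "\<And>\<alpha>. \<alpha> \<in> F \<Longrightarrow> cmod (h \<alpha>) \<le> \<eta>"
      by auto
    let ?u = "\<lambda>\<alpha>. (cmod (h \<alpha>))\<^sup>2 / weight \<alpha> ^ p"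
    have uM: "?u \<alpha> \<le> ?M \<alpha>" for \<alpha>
      using weight_pos[of \<alpha>] hB[of \<alpha>] by (intro divide_right_mono power_mono) (auto simp: less_imp_le)
    have u\<eta>: "?u \<alpha> \<le> \<eta>\<^sup>2" if "\<alpha> \<in> F" for \<alpha>
    proof -
      have "?u \<alpha> \<le> (cmod (h \<alpha>))\<^sup>2 / 1" using w1[of \<alpha>] by (intro divide_left_mono) auto
      also have "\<dots> \<le> \<eta>\<^sup>2" using h\<eta>[OF that] by (simp add: power_mono)
      finally show ?thesis .
    qed
    have "infsum ?u UNIV \<le> \<epsilon>\<^sup>2 / 2"
    proof (rule infsum_le_finite_sums)
      show "?u summable_on UNIV" using Fneg_dominated[OF B hB] by (simp add: Fneg_def)
      fix A :: "multi_index set" assume A: "finite A"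
      have "sum ?u A = sum ?u (A \<inter> F) + sum ?u (A - F)"
        using A by (rule sum.Int_Diff)
      also have "\<dots> \<le> card F * \<eta>\<^sup>2 + (infsum ?M UNIV - sum ?M F)"
      proof (rule add_mono)
        have "sum ?u (A \<inter> F) \<le> card (A \<inter> F) * \<eta>\<^sup>2"
          by (rule sum_bounded_above) (use u\<eta> in auto)
        also have "\<dots> \<le> card F * \<eta>\<^sup>2"
          using F(1) by (intro mult_right_mono) (auto intro: card_mono)
        finally show "sum ?u (A \<inter> F) \<le> card F * \<eta>\<^sup>2" .
        \<comment> \<open>Adding the majorant over \<open>F\<close> to both sides gives a finite
          partial sum over the disjoint union of \<open>A - F\<close> and \<open>F\<close>, bounded
          by the whole series.\<close>
        have "sum ?u (A - F) + sum ?M F \<le> sum ?M (A - F) + sum ?M F"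
          by (intro add_right_mono sum_mono uM)
        also have "\<dots> = sum ?M ((A - F) \<union> F)"
          using A F(1) by (subst sum.union_disjoint) auto
        also have "\<dots> \<le> infsum ?M UNIV"
          by (rule finite_sum_le_infsum[OF B]) (use A F(1) M0 in auto)
        finally show "sum ?u (A - F) \<le> infsum ?M UNIV - sum ?M F" by simp
      qed
      also have "\<dots> \<le> \<epsilon>\<^sup>2 / 2"
        using F(2) \<eta>F by (auto simp: dist_real_def abs_if split: if_splits)
      finally show "sum ?u A \<le> \<epsilon>\<^sup>2 / 2" .
    qed
    also have "\<dots> < \<epsilon>\<^sup>2" using \<open>\<epsilon> > 0\<close> by simp
    finally have "sqrt (infsum ?u UNIV) < sqrt (\<epsilon>\<^sup>2)" by (rule real_sqrt_less_mono)
    then show "Fneg_norm p h < \<epsilon>" using \<open>\<epsilon> > 0\<close> by (simp add: Fneg_norm_def)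
  qed
qed

text \<open>Upgrades coordinatewise continuity to continuity in norm. Differences of values are
  dominated by \<open>2 * B\<close>, so closeness in finitely many coordinates is enough.\<close>

lemma continuous_map_Fneg_dominated:
  fixes g :: "'a::metric_space \<Rightarrow> family"
  assumes cont: "\<And>\<alpha>. continuous_on S (\<lambda>t. g t \<alpha>)"
    and bound: "\<And>t \<alpha>. t \<in> S \<Longrightarrow> cmod (g t \<alpha>) \<le> B \<alpha>"
    and B: "(\<lambda>\<alpha>. (B \<alpha>)\<^sup>2 / weight \<alpha> ^ p) summable_on UNIV"
  shows "continuous_map (top_of_set S) (Fneg_top p) g"
proof -
  interpret Metric_space "Fneg p" "Fneg_dist p" by (rule Metric_space_Fneg)
  have gF: "g t \<in> Fneg p" if "t \<in> S" for t
    using Fneg_dominated[OF B] bound that by blast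
  have B2: "(\<lambda>\<alpha>. (2 * B \<alpha>)\<^sup>2 / weight \<alpha> ^ p) summable_on UNIV"
    using summable_on_cmult_right[OF B, of 4] by (simp add: power_mult_distrib)
  show ?thesis
    unfolding Fneg_top_def continuous_map_to_metric
  proof (intro ballI allI impI)
    fix t and \<epsilon> :: real assume "t \<in> topspace (top_of_set S)" "\<epsilon> > 0"
    then have t: "t \<in> S" by simp
    obtain F \<eta> where F: "finite F" "\<eta> > 0"
      "\<And>h. \<forall>\<alpha>. cmod (h \<alpha>) \<le> 2 * B \<alpha> \<Longrightarrow> \<forall>\<alpha>\<in>F. cmod (h \<alpha>) \<le> \<eta>
        \<Longrightarrow> Fneg_norm p h < \<epsilon>"
      using Fneg_norm_dominated_small[OF B2 \<open>\<epsilon> > 0\<close>] by blast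
    have "\<forall>\<alpha>\<in>F. \<forall>\<^sub>F s in at t within S. dist (g s \<alpha>) (g t \<alpha>) < \<eta>"
      using cont t F(2) by (auto simp: continuous_on_def intro: tendstoD)
    from eventually_ball_finite[OF F(1) this] obtain d where d: "d > 0"
      "\<And>s. s \<in> S \<Longrightarrow> s \<noteq> t \<Longrightarrow> dist s t < d \<Longrightarrow> \<forall>\<alpha>\<in>F. dist (g s \<alpha>) (g t \<alpha>) < \<eta>"
      unfolding eventually_at by blast
    show "\<exists>U. openin (top_of_set S) U \<and> t \<in> U \<and> (\<forall>y\<in>U. g y \<in> mball (g t) \<epsilon>)"
    proof (intro exI[of _ "S \<inter> ball t d"] conjI ballI)
      fix s assume s: "s \<in> S \<inter> ball t d"
      have "Fneg_norm p (\<lambda>\<alpha>. g t \<alpha> - g s \<alpha>) < \<epsilon>"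
      proof (rule F(3); intro allI ballI)
        fix \<alpha>
        show "cmod (g t \<alpha> - g s \<alpha>) \<le> 2 * B \<alpha>"
          using norm_triangle_ineq4[of "g t \<alpha>" "g s \<alpha>"] bound[of t \<alpha>] bound[of s \<alpha>] s t by auto
        show "cmod (g t \<alpha> - g s \<alpha>) \<le> \<eta>" if "\<alpha> \<in> F"
          using d(2)[of s] s that F(2)
          by (cases "s = t") (force simp: dist_commute dist_norm norm_minus_commute less_imp_le)+
      qed
      then show "g s \<in> mball (g t) \<epsilon>"
        using gF s t by (simp add: Fneg_dist_def)
    qed (use t d in auto)
  qed
qed

text \<open>Uniform continuity makes \<open>\<phi>\<close> vary by less than \<open>e\<close> on
  every interval shorter than \<open>\<delta>\<close>. Since each tag lies in its interval, the
  local errors add up to at most \<open>e * (b - a)\<close>.\<close>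

lemma Riemann_sums_converge:
  fixes \<phi> :: "real \<Rightarrow> 'a::banach"
  assumes "a \<le> b" and cont: "continuous_on {a..b} \<phi>" and "\<epsilon> > 0"
  shows "\<exists>\<delta>>0. \<forall>D. D tagged_division_of {a..b} \<and> (\<forall>(t, K)\<in>D. measure lborel K < \<delta>) \<longrightarrow>
    norm ((\<Sum>(t, K)\<in>D. measure lborel K *\<^sub>R \<phi> t) - integral {a..b} \<phi>) \<le> \<epsilon>"
proof -
  \<comment> \<open>The added 1 keeps the denominator positive when \<open>a = b\<close>.\<close>
  define e where "e = \<epsilon> / (b - a + 1)"
  have e: "e > 0" using assms by (simp add: e_def)
  have "uniformly_continuous_on {a..b} \<phi>"
    using cont by (rule compact_uniformly_continuous) simp
  then obtain \<delta> where \<delta>: "\<delta> > 0"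
    "\<And>x y. x \<in> {a..b} \<Longrightarrow> y \<in> {a..b} \<Longrightarrow> dist y x < \<delta> \<Longrightarrow> dist (\<phi> y) (\<phi> x) < e"
    using e unfolding uniformly_continuous_on_def by meson
  show ?thesis
  proof (intro exI[of _ \<delta>] conjI allI impI)
    fix D assume "D tagged_division_of {a..b} \<and> (\<forall>(t, K)\<in>D. measure lborel K < \<delta>)"
    then have D: "D tagged_division_of {a..b}" and fine: "\<And>t K. (t, K) \<in> D \<Longrightarrow> measure lborel K < \<delta>"
      by auto
    note DD = tagged_division_ofD[OF D]
    have int: "\<phi> integrable_on K" if tK: "(t, K) \<in> D" for t K
    proof -
      obtain u v where "K = {u..v}" using DD(4)[OF tK] by auto
      then show ?thesis
        using DD(3)[OF tK] cont
        by (auto intro!: integrable_continuous_interval intro: continuous_on_subset)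
    qed
    have "(\<phi> has_integral (\<Sum>(t, K)\<in>D. integral K \<phi>)) {a..b}"
      using D by (rule has_integral_combine_tagged_division) (use int in auto)
    then have "integral {a..b} \<phi> = (\<Sum>(t, K)\<in>D. integral K \<phi>)" by (rule integral_unique)
    then have "norm ((\<Sum>(t, K)\<in>D. measure lborel K *\<^sub>R \<phi> t) - integral {a..b} \<phi>)
        = norm (\<Sum>(t, K)\<in>D. measure lborel K *\<^sub>R \<phi> t - integral K \<phi>)"
      by (simp add: split_def sum_subtractf)
    also have "\<dots> \<le> (\<Sum>(t, K)\<in>D. e * measure lborel K)"
    proof (intro sum_norm_le, clarify)
      fix t K assume tK: "(t, K) \<in> D"
      obtain u v where K: "K = {u..v}" using DD(4)[OF tK] by auto
      have t: "t \<in> {u..v}" and sub: "{u..v} \<subseteq> {a..b}"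
        using DD(2,3)[OF tK] K by auto
      \<comment> \<open>The local error is itself the integral of \<open>\<phi> t - \<phi> x\<close>
        over \<open>K\<close>, so a pointwise bound on the integrand suffices.\<close>
      have "((\<lambda>x. \<phi> t - \<phi> x) has_integral (measure lborel K *\<^sub>R \<phi> t - integral K \<phi>)) {u..v}"
        using int[OF tK] has_integral_const_real[of "\<phi> t" u v] unfolding K
        by (intro has_integral_diff integrable_integral) auto
      then show "norm (measure lborel K *\<^sub>R \<phi> t - integral K \<phi>) \<le> e * measure lborel K"
        unfolding K
      proof (rule has_integral_bound_real[rotated 2])
        fix x assume x: "x \<in> {u..v} - {}"
        have "dist x t < \<delta>"
          using fine[OF tK] x t K by (auto simp: dist_real_def)
        then show "norm (\<phi> t - \<phi> x) \<le> e"
          using \<delta>(2)[of t x] x t sub by (auto simp: dist_norm norm_minus_commute subset_iff less_imp_le)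
      qed (use e in auto)
    qed
    also have "\<dots> = e * measure lborel {a..b}"
      using additive_content_tagged_division[of D a b] D
      by (simp add: split_def flip: sum_distrib_left)
    also have "\<dots> \<le> \<epsilon>"
      using assms by (simp add: e_def field_simps)
    finally show "norm ((\<Sum>(t, K)\<in>D. measure lborel K *\<^sub>R \<phi> t) - integral {a..b} \<phi>) \<le> \<epsilon>" .
  qed (rule \<delta>(1))
qed

text \<open>The integral is taken coordinate by coordinate. Both it and every Riemann sum are
  dominated by \<open>(b - a) * B\<close>, so norm convergence reduces to scalar convergence in
  finitely many coordinates.\<close>

lemma has_Riemann_integral_Fneg_dominated:
  assumes "a \<le> b"
    and cont: "\<And>\<alpha>. continuous_on {a..b} (\<lambda>t. g t \<alpha>)"
    and bound: "\<And>t \<alpha>. t \<in> {a..b} \<Longrightarrow> cmod (g t \<alpha>) \<le> B \<alpha>"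
    and B: "(\<lambda>\<alpha>. (B \<alpha>)\<^sup>2 / weight \<alpha> ^ p) summable_on UNIV"
  shows "has_Riemann_integral_Fneg p g (\<lambda>\<alpha>. integral {a..b} (\<lambda>t. g t \<alpha>)) a b"
proof -
  let ?I = "\<lambda>\<alpha>. integral {a..b} (\<lambda>t. g t \<alpha>)"
  have scaled: "(\<lambda>\<alpha>. (c * B \<alpha>)\<^sup>2 / weight \<alpha> ^ p) summable_on UNIV" for c
    using summable_on_cmult_right[OF B, of "c\<^sup>2"] by (simp add: power_mult_distrib)
  have I: "cmod (?I \<alpha>) \<le> (b - a) * B \<alpha>" for \<alpha>
    using integral_bound[OF \<open>a \<le> b\<close> cont, of \<alpha> "B \<alpha>"] bound by (simp add: mult.commute)
  have I_Fneg: "?I \<in> Fneg p" by (rule Fneg_dominated[OF scaled I])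
  have g_Fneg: "g ` {a..b} \<subseteq> Fneg p" using Fneg_dominated[OF B bound] by auto
  \<comment> \<open>The lengths of the intervals of a tagged division add up to
    \<open>b - a\<close>, whatever the mesh.\<close>
  have S: "cmod (\<Sum>(t, K)\<in>D. of_real (measure lborel K) * g t \<alpha>) \<le> (b - a) * B \<alpha>"
    if D: "D tagged_division_of {a..b}" for D \<alpha>
  proof -
    have "cmod (\<Sum>(t, K)\<in>D. of_real (measure lborel K) * g t \<alpha>) \<le> (\<Sum>(t, K)\<in>D. measure lborel K * B \<alpha>)"
    proof (intro sum_norm_le, clarify)
      fix t K assume "(t, K) \<in> D"
      then have "t \<in> {a..b}" using tagged_division_ofD(2,3)[OF D] by blast
      then show "cmod (of_real (measure lborel K) * g t \<alpha>) \<le> measure lborel K * B \<alpha>"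
        using bound by (simp add: norm_mult mult_left_mono)
    qed
    also have "\<dots> = measure lborel {a..b} * B \<alpha>"
      using additive_content_tagged_division[of D a b] D
      by (simp add: split_def flip: sum_distrib_right)
    finally show ?thesis using \<open>a \<le> b\<close> by simp
  qed
  show ?thesis
    unfolding has_Riemann_integral_Fneg_def
  proof (intro conjI allI impI I_Fneg g_Fneg)
    fix \<epsilon> :: real assume "\<epsilon> > 0"
    obtain F \<eta> where F: "finite F" "\<eta> > 0"
      "\<And>h. \<forall>\<alpha>. cmod (h \<alpha>) \<le> 2 * (b - a) * B \<alpha> \<Longrightarrow> \<forall>\<alpha>\<in>F. cmod (h \<alpha>) \<le> \<eta>
        \<Longrightarrow> Fneg_norm p h < \<epsilon>"
      using Fneg_norm_dominated_small[OF scaled \<open>\<epsilon> > 0\<close>] by blast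
    have "\<forall>\<alpha>. \<exists>\<delta>>0. \<forall>D. D tagged_division_of {a..b} \<and> (\<forall>(t, K)\<in>D. measure lborel K < \<delta>) \<longrightarrow>
        cmod ((\<Sum>(t, K)\<in>D. of_real (measure lborel K) * g t \<alpha>) - ?I \<alpha>) \<le> \<eta>"
      using Riemann_sums_converge[OF \<open>a \<le> b\<close> cont F(2)] by (simp add: scaleR_conv_of_real)
    then obtain d where d: "\<And>\<alpha>. d \<alpha> > 0"
      "\<And>\<alpha> D. D tagged_division_of {a..b} \<Longrightarrow> \<forall>(t, K)\<in>D. measure lborel K < d \<alpha> \<Longrightarrow>
        cmod ((\<Sum>(t, K)\<in>D. of_real (measure lborel K) * g t \<alpha>) - ?I \<alpha>) \<le> \<eta>"
      by metis
    \<comment> \<open>The scalar mesh bound \<open>d \<alpha>\<close> depends on the coordinate;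
      only those in the finite \<open>F\<close> need a common one. Inserting 1 handles an empty
      \<open>F\<close>.\<close>
    define \<delta> where "\<delta> = Min (insert 1 (d ` F))"
    have \<delta>: "\<delta> > 0" "\<And>\<alpha>. \<alpha> \<in> F \<Longrightarrow> \<delta> \<le> d \<alpha>"
      using F(1) d(1) by (auto simp: \<delta>_def)
    show "\<exists>\<delta>>0. \<forall>D. D tagged_division_of {a..b} \<and> (\<forall>(t, K)\<in>D. measure lborel K < \<delta>) \<longrightarrow>
        Fneg_dist p (\<lambda>\<alpha>. \<Sum>(t, K)\<in>D. of_real (measure lborel K) * g t \<alpha>) ?I < \<epsilon>"
    proof (intro exI[of _ \<delta>] conjI allI impI \<delta>(1))
      fix D assume *: "D tagged_division_of {a..b} \<and> (\<forall>(t, K)\<in>D. measure lborel K < \<delta>)"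
      show "Fneg_dist p (\<lambda>\<alpha>. \<Sum>(t, K)\<in>D. of_real (measure lborel K) * g t \<alpha>) ?I < \<epsilon>"
        unfolding Fneg_dist_def
      proof (rule F(3); intro allI ballI)
        fix \<alpha>
        show "cmod ((\<Sum>(t, K)\<in>D. of_real (measure lborel K) * g t \<alpha>) - ?I \<alpha>) \<le> 2 * (b - a) * B \<alpha>"
          using norm_triangle_ineq4[of "\<Sum>(t, K)\<in>D. of_real (measure lborel K) * g t \<alpha>" "?I \<alpha>"]
            S[of D \<alpha>] I[of \<alpha>] * by (simp add: algebra_simps)
        assume "\<alpha> \<in> F"
        then show "cmod ((\<Sum>(t, K)\<in>D. of_real (measure lborel K) * g t \<alpha>) - ?I \<alpha>) \<le> \<eta>"
          using * \<delta>(2)[of \<alpha>] by (intro d(2)) fastforce+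
      qed
    qed
  qed
qed

subsection \<open>Continuous maps into the inductive limit\<close>

lemma Fdist_nbhd0_lincomb:
  assumes "Fdist_nbhd0 U" "f \<in> U" "g \<in> U" "cmod a + cmod b \<le> 1"
  shows "(\<lambda>\<alpha>. a * f \<alpha> + b * g \<alpha>) \<in> U"
  using assms(1)[unfolded Fdist_nbhd0_def] assms(2-) by simp

text \<open>Supplies a neighbourhood \<open>W\<close> with \<open>W + W\<close> inside
  \<open>U\<close>: by absolute convexity, \<open>h + k\<close> is the average of
  \<open>2 * h\<close> and \<open>2 * k\<close>.\<close>

lemma Fdist_nbhd0_half:
  assumes "Fdist_nbhd0 U"
  shows "Fdist_nbhd0 {h \<in> Fdist. (\<lambda>\<alpha>. 2 * h \<alpha>) \<in> U}"
  unfolding Fdist_nbhd0_def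
proof (intro conjI ballI allI impI)
  fix h k and c d :: complex
  assume *: "h \<in> {h \<in> Fdist. (\<lambda>\<alpha>. 2 * h \<alpha>) \<in> U}" "k \<in> {h \<in> Fdist. (\<lambda>\<alpha>. 2 * h \<alpha>) \<in> U}"
    "cmod c + cmod d \<le> 1"
  then have "(\<lambda>\<alpha>. c * (2 * h \<alpha>) + d * (2 * k \<alpha>)) \<in> U"
    using Fdist_nbhd0_lincomb[OF assms] by simp
  then have "(\<lambda>\<alpha>. 2 * (c * h \<alpha> + d * k \<alpha>)) \<in> U" by (simp add: algebra_simps)
  then show "(\<lambda>\<alpha>. c * h \<alpha> + d * k \<alpha>) \<in> {h \<in> Fdist. (\<lambda>\<alpha>. 2 * h \<alpha>) \<in> U}"
    using * Fdist_lincomb by auto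
next
  fix p :: nat assume "1 \<le> p"
  then obtain r where r: "r > 0" "{f \<in> Fneg p. Fneg_norm p f < r} \<subseteq> U"
    using assms unfolding Fdist_nbhd0_def by meson
  have "{f \<in> Fneg p. Fneg_norm p f < r / 2} \<subseteq> {h \<in> Fdist. (\<lambda>\<alpha>. 2 * h \<alpha>) \<in> U}"
  proof clarify
    fix h assume h: "h \<in> Fneg p" "Fneg_norm p h < r / 2"
    have 2: "(\<lambda>\<alpha>. 2 * h \<alpha>) \<in> Fneg p" using Fneg_lincomb[OF h(1) h(1), of 2 0] by simp
    have "(\<lambda>\<alpha>. (cmod (2 * h \<alpha>))\<^sup>2 / weight \<alpha> ^ p) = (\<lambda>\<alpha>. 4 * ((cmod (h \<alpha>))\<^sup>2 / weight \<alpha> ^ p))"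
      by (simp add: norm_mult power_mult_distrib)
    then have "Fneg_norm p (\<lambda>\<alpha>. 2 * h \<alpha>) = 2 * Fneg_norm p h"
      unfolding Fneg_norm_def by (simp add: infsum_cmult_right' real_sqrt_mult del: times_divide_eq_right)
    with h 2 r(2) \<open>1 \<le> p\<close> show "h \<in> Fdist \<and> (\<lambda>\<alpha>. 2 * h \<alpha>) \<in> U"
      by (auto simp: Fdist_def)
  qed
  with r(1) show "\<exists>r>0. {f \<in> Fneg p. Fneg_norm p f < r} \<subseteq> {h \<in> Fdist. (\<lambda>\<alpha>. 2 * h \<alpha>) \<in> U}"
    by (intro exI[of _ "r / 2"]) auto
qed auto

lemma Fdist_nbhd0_zero:
  assumes "Fdist_nbhd0 U"
  shows "(\<lambda>_. 0) \<in> U"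
proof -
  obtain r where "r > 0" "{f \<in> Fneg 1. Fneg_norm 1 f < r} \<subseteq> U"
    using assms unfolding Fdist_nbhd0_def by (meson order_refl)
  moreover have "(\<lambda>_. 0) \<in> Fneg 1" "Fneg_norm 1 (\<lambda>_. 0) = 0"
    by (auto simp: Fneg_def Fneg_norm_def)
  ultimately show ?thesis by auto
qed

text \<open>A neighbourhood \<open>U\<close> of 0 need not be open, so the translate
  \<open>f + U\<close> cannot itself serve as \<open>V\<close>. Its interior does.\<close>

lemma Fdist_nbhd0_translate:
  assumes U: "Fdist_nbhd0 U" and f: "f \<in> Fdist"
  obtains V where "openin Fdist_top V" "f \<in> V" "\<And>g. g \<in> V \<Longrightarrow> (\<lambda>\<alpha>. g \<alpha> - f \<alpha>) \<in> U"
proof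
  \<comment> \<open>The interior of \<open>f + U\<close>: points having a whole translated
    neighbourhood of 0 inside \<open>f + U\<close>.\<close>
  define V where "V = {g \<in> Fdist. \<exists>W. Fdist_nbhd0 W \<and> (\<forall>h\<in>W. (\<lambda>\<alpha>. g \<alpha> + h \<alpha> - f \<alpha>) \<in> U)}"
  show "f \<in> V" using U f by (auto simp: V_def)
  show "(\<lambda>\<alpha>. g \<alpha> - f \<alpha>) \<in> U" if "g \<in> V" for g
  proof -
    obtain W where W: "Fdist_nbhd0 W" "\<forall>h\<in>W. (\<lambda>\<alpha>. g \<alpha> + h \<alpha> - f \<alpha>) \<in> U"
      using \<open>g \<in> V\<close> by (auto simp: V_def)
    show ?thesis using bspec[OF W(2) Fdist_nbhd0_zero[OF W(1)]] by simp
  qed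
  show "openin Fdist_top V"
    unfolding openin_Fdist_top Fdist_open_def
  proof (intro conjI ballI)
    fix g assume "g \<in> V"
    then obtain W where g: "g \<in> Fdist"
      and W: "Fdist_nbhd0 W" "\<forall>h\<in>W. (\<lambda>\<alpha>. g \<alpha> + h \<alpha> - f \<alpha>) \<in> U"
      by (auto simp: V_def)
    \<comment> \<open>Openness of \<open>V\<close> at \<open>g\<close> spends one half of
      \<open>W\<close> on moving to \<open>g + h\<close> and keeps the other half as a neighbourhood
      around that point.\<close>
    let ?W = "{h \<in> Fdist. (\<lambda>\<alpha>. 2 * h \<alpha>) \<in> W}"
    have "(\<lambda>\<alpha>. g \<alpha> + h \<alpha>) \<in> V" if h: "h \<in> ?W" for h
    proof -
      have "(\<lambda>\<alpha>. g \<alpha> + h \<alpha> + k \<alpha> - f \<alpha>) \<in> U" if k: "k \<in> ?W" for k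
      proof -
        have "(\<lambda>\<alpha>. (1/2) * (2 * h \<alpha>) + (1/2) * (2 * k \<alpha>)) \<in> W"
          using h k by (intro Fdist_nbhd0_lincomb[OF W(1)]) auto
        then have "(\<lambda>\<alpha>. h \<alpha> + k \<alpha>) \<in> W" by simp
        from bspec[OF W(2) this] show ?thesis by (simp add: add.assoc)
      qed
      moreover have "(\<lambda>\<alpha>. g \<alpha> + h \<alpha>) \<in> Fdist"
        using Fdist_lincomb[OF g, of h 1 1] h by simp
      ultimately show ?thesis
        using Fdist_nbhd0_half[OF W(1)] unfolding V_def by blast
    qed
    then show "\<exists>U. Fdist_nbhd0 U \<and> (\<forall>h\<in>U. (\<lambda>\<alpha>. g \<alpha> + h \<alpha>) \<in> V)"
      using Fdist_nbhd0_half[OF W(1)] by blast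
  qed (auto simp: V_def)
qed

text \<open>The norm gives the square root of \<open>weight \<alpha> ^ p\<close>. As the weight is
  at least 1, this is rounded up to a natural power.\<close>

lemma cmod_le_Fneg_norm:
  assumes "f \<in> Fneg p"
  shows "cmod (f \<alpha>) \<le> Fneg_norm p f * weight \<alpha> ^ p"
proof -
  have w: "1 \<le> weight \<alpha> ^ p" by (rule one_le_power[OF weight_ge_1])
  have "cmod (f \<alpha>) / sqrt (weight \<alpha> ^ p) \<le> Fneg_norm p f"
    using L2_set_le_Fneg_norm[OF assms, of "{\<alpha>}"] w by (simp add: L2_set_def)
  then have "cmod (f \<alpha>) \<le> Fneg_norm p f * sqrt (weight \<alpha> ^ p)"
    using w by (simp add: pos_divide_le_eq)
  also have "sqrt (weight \<alpha> ^ p) \<le> weight \<alpha> ^ p"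
    using w by (intro real_le_lsqrt) (auto simp: power2_eq_square)
  finally show ?thesis using Fneg_norm_nonneg by (simp add: mult_left_mono)
qed

text \<open>The constraints with \<open>n \<ge> p\<close> hold on the
  unit ball of \<open>Fneg p\<close>, which leaves only finitely many others.\<close>

lemma Fdist_nbhd0_power_bounds:
  fixes A :: "nat \<Rightarrow> multi_index"
  shows "Fdist_nbhd0 {h \<in> Fdist. \<forall>n. cmod (h (A n)) \<le> weight (A n) ^ n}"
  unfolding Fdist_nbhd0_def
proof (intro conjI ballI allI impI)
  fix h k and c d :: complex
  assume *: "h \<in> {h \<in> Fdist. \<forall>n. cmod (h (A n)) \<le> weight (A n) ^ n}"
    "k \<in> {h \<in> Fdist. \<forall>n. cmod (h (A n)) \<le> weight (A n) ^ n}" "cmod c + cmod d \<le> 1"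
  have "cmod (c * h (A n) + d * k (A n)) \<le> weight (A n) ^ n" for n
  proof -
    have "cmod (c * h (A n) + d * k (A n)) \<le> cmod c * cmod (h (A n)) + cmod d * cmod (k (A n))"
      by (metis norm_mult norm_triangle_ineq)
    also have "\<dots> \<le> cmod c * weight (A n) ^ n + cmod d * weight (A n) ^ n"
      using * by (intro add_mono mult_left_mono) auto
    also have "\<dots> = (cmod c + cmod d) * weight (A n) ^ n" by (simp add: algebra_simps)
    also have "\<dots> \<le> 1 * weight (A n) ^ n"
      using * weight_pos[of "A n"] by (intro mult_right_mono) (auto simp: less_imp_le)
    finally show ?thesis by simp
  qed
  then show "(\<lambda>\<alpha>. c * h \<alpha> + d * k \<alpha>) \<in> {h \<in> Fdist. \<forall>n. cmod (h (A n)) \<le> weight (A n) ^ n}"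
    using * Fdist_lincomb by auto
next
  fix p :: nat assume "1 \<le> p"
  define r where "r = Min (insert 1 ((\<lambda>n. 1 / weight (A n) ^ p) ` {..<p}))"
  have r: "r > 0" "r \<le> 1" "\<And>n. n < p \<Longrightarrow> r \<le> 1 / weight (A n) ^ p"
    using weight_pos by (auto simp: r_def)
  have "{f \<in> Fneg p. Fneg_norm p f < r} \<subseteq> {h \<in> Fdist. \<forall>n. cmod (h (A n)) \<le> weight (A n) ^ n}"
  proof clarify
    fix h assume h: "h \<in> Fneg p" "Fneg_norm p h < r"
    have "cmod (h (A n)) \<le> weight (A n) ^ n" for n
    proof -
      have w: "0 < weight (A n) ^ p" using weight_pos by simp
      have 1: "cmod (h (A n)) \<le> r * weight (A n) ^ p"
        using cmod_le_Fneg_norm[OF h(1), of "A n"] h(2) w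
        by (smt (verit) mult_right_mono)
      show ?thesis
      proof (cases "n < p")
        case True
        have "r * weight (A n) ^ p \<le> 1" using r(3)[OF True] w by (simp add: pos_le_divide_eq)
        also have "\<dots> \<le> weight (A n) ^ n" by (rule one_le_power[OF weight_ge_1])
        finally show ?thesis using 1 by simp
      next
        case False
        then have "weight (A n) ^ p \<le> weight (A n) ^ n"
          using weight_ge_1 by (intro power_increasing) auto
        moreover have "r * weight (A n) ^ p \<le> 1 * weight (A n) ^ p"
          using r(2) w by (intro mult_right_mono) auto
        ultimately show ?thesis using 1 by simp
      qed
    qed
    then show "h \<in> Fdist \<and> (\<forall>n. cmod (h (A n)) \<le> weight (A n) ^ n)"
      using h(1) \<open>1 \<le> p\<close> by (auto simp: Fdist_def)
  qed
  with r(1) show "\<exists>r>0. {f \<in> Fneg p. Fneg_norm p f < r}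
      \<subseteq> {h \<in> Fdist. \<forall>n. cmod (h (A n)) \<le> weight (A n) ^ n}" by blast
qed auto

text \<open>Each coordinate functional is bounded on every step \<open>Fneg p\<close>, so its small
  values form a neighbourhood of 0. This yields continuity of the coordinates of a continuous
  map.\<close>

lemma Fdist_nbhd0_coordinate:
  assumes "\<epsilon> > 0"
  shows "Fdist_nbhd0 {h \<in> Fdist. cmod (h \<alpha>) \<le> \<epsilon>}"
  unfolding Fdist_nbhd0_def
proof (intro conjI ballI allI impI)
  fix h k and c d :: complex
  assume *: "h \<in> {h \<in> Fdist. cmod (h \<alpha>) \<le> \<epsilon>}"
    "k \<in> {h \<in> Fdist. cmod (h \<alpha>) \<le> \<epsilon>}" "cmod c + cmod d \<le> 1"
  have "cmod (c * h \<alpha> + d * k \<alpha>) \<le> cmod c * cmod (h \<alpha>) + cmod d * cmod (k \<alpha>)"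
    by (metis norm_mult norm_triangle_ineq)
  also have "\<dots> \<le> cmod c * \<epsilon> + cmod d * \<epsilon>"
    using * by (intro add_mono mult_left_mono) auto
  also have "\<dots> = (cmod c + cmod d) * \<epsilon>" by (simp add: algebra_simps)
  also have "\<dots> \<le> 1 * \<epsilon>"
    using * assms by (intro mult_right_mono) auto
  finally show "(\<lambda>\<alpha>. c * h \<alpha> + d * k \<alpha>) \<in> {h \<in> Fdist. cmod (h \<alpha>) \<le> \<epsilon>}"
    using * Fdist_lincomb by auto
next
  fix p :: nat assume "1 \<le> p"
  have w: "0 < weight \<alpha> ^ p" using weight_pos by simp
  have "{f \<in> Fneg p. Fneg_norm p f < \<epsilon> / weight \<alpha> ^ p} \<subseteq> {h \<in> Fdist. cmod (h \<alpha>) \<le> \<epsilon>}"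
  proof clarify
    fix h assume h: "h \<in> Fneg p" "Fneg_norm p h < \<epsilon> / weight \<alpha> ^ p"
    then have "Fneg_norm p h * weight \<alpha> ^ p \<le> \<epsilon>" using w by (simp add: pos_less_divide_eq less_imp_le)
    with cmod_le_Fneg_norm[OF h(1), of \<alpha>] show "h \<in> Fdist \<and> cmod (h \<alpha>) \<le> \<epsilon>"
      using h(1) \<open>1 \<le> p\<close> by (auto simp: Fdist_def)
  qed
  then show "\<exists>r>0. {f \<in> Fneg p. Fneg_norm p f < r} \<subseteq> {h \<in> Fdist. cmod (h \<alpha>) \<le> \<epsilon>}"
    using assms w by (intro exI[of _ "\<epsilon> / weight \<alpha> ^ p"]) auto
qed auto

lemma continuous_map_Fdist_eventually:
  fixes f :: "'a::metric_space \<Rightarrow> family"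
  assumes f: "continuous_map (top_of_set S) Fdist_top f" and z: "z \<in> S" and U: "Fdist_nbhd0 U"
  obtains d where "d > 0" "\<And>w. w \<in> S \<Longrightarrow> dist w z < d \<Longrightarrow> (\<lambda>\<alpha>. f w \<alpha> - f z \<alpha>) \<in> U"
proof -
  have "f z \<in> Fdist" using continuous_map_image_subset_topspace[OF f] z by auto
  then obtain V where V: "openin Fdist_top V" "f z \<in> V" "\<And>g. g \<in> V \<Longrightarrow> (\<lambda>\<alpha>. g \<alpha> - f z \<alpha>) \<in> U"
    using Fdist_nbhd0_translate[OF U] by metis
  have "openin (top_of_set S) {w \<in> S. f w \<in> V}"
    using openin_continuous_map_preimage[OF f V(1)] by simp
  then obtain d where "d > 0" "\<And>w. w \<in> S \<Longrightarrow> dist w z < d \<Longrightarrow> f w \<in> V"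
    using z V(2) unfolding openin_euclidean_subtopology_iff by blast
  with V(3) that show thesis by blast
qed

lemma continuous_on_Fdist_coordinate:
  fixes f :: "'a::metric_space \<Rightarrow> family"
  assumes f: "continuous_map (top_of_set S) Fdist_top f"
  shows "continuous_on S (\<lambda>z. f z \<alpha>)"
  unfolding continuous_on_iff
proof (intro ballI allI impI)
  fix z and e :: real assume z: "z \<in> S" and "e > 0"
  \<comment> \<open>Half of \<open>e\<close> turns the non-strict bound of the neighbourhood into
    the strict one required.\<close>
  then have "Fdist_nbhd0 {h \<in> Fdist. cmod (h \<alpha>) \<le> e / 2}" by (intro Fdist_nbhd0_coordinate) simp
  then obtain d where d: "d > 0"
    "\<And>w. w \<in> S \<Longrightarrow> dist w z < d \<Longrightarrow> (\<lambda>\<alpha>. f w \<alpha> - f z \<alpha>) \<in> {h \<in> Fdist. cmod (h \<alpha>) \<le> e / 2}"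
    using continuous_map_Fdist_eventually[OF f z] by blast
  then show "\<exists>d>0. \<forall>w\<in>S. dist w z < d \<longrightarrow> dist (f w \<alpha>) (f z \<alpha>) < e"
    using \<open>e > 0\<close> by (force simp: dist_norm intro!: exI[of _ d])
qed

text \<open>If no bound works, there are points \<open>Z n\<close> and multi-indices \<open>A n\<close> with
  \<open>cmod (f (Z n) (A n)) > n * weight (A n) ^ n\<close>. The neighbourhood of \<open>0\<close> that
  \<open>Fdist_nbhd0_power_bounds\<close> builds from \<open>A\<close> then contradicts continuity at an accumulation point of \<open>Z\<close>.\<close>

lemma continuous_map_Fdist_compact_bound:
  fixes f :: "'a::metric_space \<Rightarrow> family"
  assumes S: "compact S" and f: "continuous_map (top_of_set S) Fdist_top f"
  obtains C q where "0 \<le> C" "\<And>z \<alpha>. z \<in> S \<Longrightarrow> cmod (f z \<alpha>) \<le> C * weight \<alpha> ^ q"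
proof (rule ccontr)
  assume *: "\<not> thesis"
  have "\<exists>z \<alpha>. z \<in> S \<and> real n * weight \<alpha> ^ n < cmod (f z \<alpha>)" for n
    using * that[of "real n" n] by (meson not_le of_nat_0_le_iff)
  then obtain Z A where ZA: "\<And>n. Z n \<in> S" "\<And>n. real n * weight (A n) ^ n < cmod (f (Z n) (A n))"
    by metis
  obtain z r where z: "z \<in> S" and r: "strict_mono (r :: nat \<Rightarrow> nat)" and lim: "(Z \<circ> r) \<longlonglongrightarrow> z"
    using S ZA(1) unfolding compact_def by meson
  obtain d where d: "d > 0"
    "\<And>w. w \<in> S \<Longrightarrow> dist w z < d \<Longrightarrow>
      (\<lambda>\<alpha>. f w \<alpha> - f z \<alpha>) \<in> {h \<in> Fdist. \<forall>n. cmod (h (A n)) \<le> weight (A n) ^ n}"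
    using continuous_map_Fdist_eventually[OF f z Fdist_nbhd0_power_bounds[of A]] by blast
  have "f z \<in> Fdist" using continuous_map_image_subset_topspace[OF f] z by auto
  then obtain p where p: "f z \<in> Fneg p" by (auto simp: Fdist_def)
  have "\<forall>\<^sub>F n in sequentially. dist ((Z \<circ> r) n) z < d" using lim d(1) by (rule tendstoD)
  then obtain N where N: "\<And>n. n \<ge> N \<Longrightarrow> dist (Z (r n)) z < d"
    by (auto simp: eventually_sequentially)
  obtain M where M: "Fneg_norm p (f z) + 1 \<le> real M" using real_arch_simple by blast
  \<comment> \<open>A strictly increasing \<open>r\<close> satisfies \<open>r k \<ge> k\<close>. The
    summand \<open>N\<close> brings \<open>Z n\<close> close to \<open>z\<close>, \<open>M\<close>
    makes \<open>n\<close> exceed the constant for \<open>f z\<close>, and \<open>p\<close> makes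
    the power \<open>n\<close> dominate the power \<open>p\<close>.\<close>
  define n where "n = r (N + M + p)"
  have n: "M \<le> n" "p \<le> n" using seq_suble[OF r, of "N + M + p"] by (auto simp: n_def)
  have w: "weight (A n) ^ p \<le> weight (A n) ^ n"
    using weight_ge_1 n by (intro power_increasing) auto
  have "cmod (f z (A n)) \<le> Fneg_norm p (f z) * weight (A n) ^ p" by (rule cmod_le_Fneg_norm[OF p])
  also have "\<dots> \<le> Fneg_norm p (f z) * weight (A n) ^ n"
    using w Fneg_norm_nonneg by (intro mult_left_mono) auto
  finally have 1: "cmod (f z (A n)) \<le> Fneg_norm p (f z) * weight (A n) ^ n" .
  have "cmod (f (Z n) (A n) - f z (A n)) \<le> weight (A n) ^ n"
    using d(2)[OF ZA(1), of n] N[of "N + M + p"] by (auto simp: n_def)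
  then have "cmod (f (Z n) (A n)) \<le> (Fneg_norm p (f z) + 1) * weight (A n) ^ n"
    using 1 norm_triangle_sub[of "f (Z n) (A n)" "f z (A n)"] by (simp add: algebra_simps)
  also have "\<dots> \<le> real n * weight (A n) ^ n"
    using M n weight_pos[of "A n"] by (intro mult_right_mono) (auto simp: less_imp_le)
  finally show False using ZA(2)[of n] by simp
qed

subsection \<open>Growth of the Hermite functions\<close>

lemma continuous_on_hermite_fun: "continuous_on S (hermite_fun n)"
proof -
  have "(deriv ^^ n) (\<lambda>w::complex. exp (- (w\<^sup>2))) holomorphic_on UNIV"
    by (intro holomorphic_higher_deriv holomorphic_intros) auto
  then have "continuous_on S ((deriv ^^ n) (\<lambda>w::complex. exp (- (w\<^sup>2))))"
    by (meson holomorphic_on_imp_continuous_on continuous_on_subset subset_UNIV)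
  then show ?thesis
    unfolding hermite_fun_def hermite_H_def by (intro continuous_intros) auto
qed

text \<open>Cauchy's inequality on the circle of radius \<open>r = sqrt (n + 1)\<close> is good enough, since
  \<open>sqrt (n!) \<le> r\<^sup>n\<close> and the Gaussian is at most \<open>exp ((R + r)\<^sup>2)\<close> there.\<close>

lemma cmod_hermite_fun_le:
  assumes "cmod z \<le> R"
  shows "cmod (hermite_fun n z) \<le> exp (4 * R\<^sup>2) * 16 ^ (n + 1)"
proof -
  have z2: "(cmod z)\<^sup>2 \<le> R\<^sup>2" using assms by (intro power_mono) auto
  define r where "r = sqrt (real n + 1)"
  have r: "r > 0" "r\<^sup>2 = real n + 1" by (auto simp: r_def)
  let ?G = "\<lambda>w::complex. exp (- (w\<^sup>2))"
  have "cmod ((deriv ^^ n) ?G z) \<le> fact n * exp ((R + r)\<^sup>2) / r ^ n"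
  proof (rule Cauchy_inequality)
    fix x assume x: "cmod (z - x) = r"
    have "cmod x \<le> R + r"
      using x assms norm_triangle_sub[of x z] by (simp add: norm_minus_commute)
    then have "(cmod x)\<^sup>2 \<le> (R + r)\<^sup>2" by (intro power_mono) auto
    moreover have "cmod (?G x) \<le> exp ((cmod x)\<^sup>2)"
      using norm_exp[of "- (x\<^sup>2)"] by (simp add: norm_power)
    ultimately show "cmod (?G x) \<le> exp ((R + r)\<^sup>2)" by (meson exp_le_cancel_iff order_trans)
  qed (use r in \<open>auto intro!: holomorphic_intros continuous_intros\<close>)
  moreover have "fact n / r ^ n \<le> sqrt (fact n)"
  proof -
    have "(fact n :: real) \<le> real n ^ n" using fact_le_power[of n] by simp
    also have "\<dots> \<le> (r\<^sup>2) ^ n" unfolding r(2) by (intro power_mono) auto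
    finally have "sqrt (fact n) \<le> r ^ n"
      using r(1) by (intro real_le_lsqrt) (auto simp: power_mult[symmetric] mult.commute)
    then have "sqrt (fact n) * sqrt (fact n) \<le> sqrt (fact n) * r ^ n"
      by (intro mult_left_mono) auto
    then show ?thesis using r(1) by (simp add: pos_divide_le_eq)
  qed
  ultimately have der: "cmod ((deriv ^^ n) ?G z) \<le> sqrt (fact n) * exp ((R + r)\<^sup>2)"
    by (smt (verit) exp_ge_zero mult_right_mono times_divide_eq_left)
  \<comment> \<open>The normalizing constant; its factor \<open>1 / sqrt (fact n)\<close> absorbs
    the \<open>sqrt (fact n)\<close> left by Cauchy's inequality.\<close>
  define c where "c = 1 / (pi powr (1/4) * 2 powr (real n / 2) * sqrt (fact n))"
  have c: "0 \<le> c" "c * sqrt (fact n) \<le> 1"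
  proof -
    have "1 \<le> pi powr (1/4)" using pi_ge_two by (intro ge_one_powr_ge_zero) auto
    moreover have "(1::real) \<le> 2 powr (real n / 2)" by (intro ge_one_powr_ge_zero) auto
    ultimately have "1 * 1 \<le> pi powr (1/4) * 2 powr (real n / 2)" by (intro mult_mono) auto
    then show "0 \<le> c" "c * sqrt (fact n) \<le> 1"
      unfolding c_def by (auto simp: field_simps)
  qed
  have e1: "cmod (exp (- (z\<^sup>2) / 2)) \<le> exp (R\<^sup>2 / 2)"
    using norm_exp[of "- (z\<^sup>2) / 2"] z2
    by (simp add: norm_power norm_divide)
  have e2: "cmod (exp (z\<^sup>2)) \<le> exp (R\<^sup>2)"
    using norm_exp[of "z\<^sup>2"] z2 by (simp add: norm_power)
  have "cmod (hermite_fun n z)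
      = c * cmod (exp (- (z\<^sup>2) / 2)) * (cmod (exp (z\<^sup>2)) * cmod ((deriv ^^ n) ?G z))"
    unfolding hermite_fun_def hermite_H_def c_def[symmetric]
    by (simp only: norm_mult norm_power norm_of_real norm_minus_cancel norm_one power_one) (use c in simp)
  also have "\<dots> \<le> c * exp (R\<^sup>2 / 2) * (exp (R\<^sup>2) * (sqrt (fact n) * exp ((R + r)\<^sup>2)))"
    using e1 e2 der c by (intro mult_mono) auto
  also have "\<dots> = (c * sqrt (fact n)) * (exp (R\<^sup>2 / 2) * exp (R\<^sup>2) * exp ((R + r)\<^sup>2))"
    by (simp add: algebra_simps)
  also have "\<dots> \<le> 1 * (exp (R\<^sup>2 / 2) * exp (R\<^sup>2) * exp ((R + r)\<^sup>2))"
    using c by (intro mult_right_mono) auto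
  also have "\<dots> = exp (R\<^sup>2 / 2 + R\<^sup>2 + (R + r)\<^sup>2)" by (simp only: exp_add mult_1)
  also have "\<dots> \<le> exp (4 * R\<^sup>2 + 2 * (real n + 1))"
  proof -
    have "R\<^sup>2 / 2 + R\<^sup>2 + (R + r)\<^sup>2 \<le> 4 * R\<^sup>2 + 2 * (real n + 1)"
    proof -
      have "x / 2 + x + y \<le> 4 * x + m" if "0 \<le> x" "y \<le> 2 * x + m" for x y m :: real
        using that by simp
      moreover have "(R + r)\<^sup>2 \<le> 2 * R\<^sup>2 + 2 * (real n + 1)"
        using sum_squares_bound[of R r] r(2) by (simp add: power2_sum)
      ultimately show ?thesis using zero_le_power2 by blast
    qed
    then show ?thesis by simp
  qed
  also have "\<dots> = exp (4 * R\<^sup>2) * exp 2 ^ (n + 1)"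
    by (simp add: exp_add flip: exp_of_nat_mult)
  \<comment> \<open>The crude base 16 is \<open>2 ^ 4\<close>, so \<open>16 ^ (n + 1)\<close> is the
    fourth power of the weight of the n-th unit multi-index.\<close>
  also have "\<dots> \<le> exp (4 * R\<^sup>2) * 16 ^ (n + 1)"
  proof -
    have "exp (2::real) = exp 1 * exp 1" by (simp flip: exp_add)
    also have "\<dots> \<le> 3 * 3" using exp_le by (intro mult_mono) auto
    finally have "exp (2::real) \<le> 16" by simp
    then show ?thesis by (intro mult_left_mono power_mono) auto
  qed
  finally show ?thesis .
qed

subsection \<open>The Wick product with the white noise\<close>

lemma continuous_on_white_noise: "continuous_on S (\<lambda>z. white_noise z \<alpha>)"
proof (cases "\<exists>n. \<alpha> = Poly_Mapping.single n 1")
  case True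
  then show ?thesis using continuous_on_hermite_fun by (auto simp: white_noise_single simp del: One_nat_def)
next
  case False
  then show ?thesis by (simp add: white_noise_eq_0)
qed

lemma cmod_white_noise_le:
  assumes "cmod z \<le> R"
  shows "cmod (white_noise z \<alpha>) \<le> exp (4 * R\<^sup>2) * weight \<alpha> ^ 4"
proof (cases "\<exists>n. \<alpha> = Poly_Mapping.single n 1")
  case True
  then obtain n where n: "\<alpha> = Poly_Mapping.single n 1" ..
  have "weight \<alpha> ^ 4 = (2 ^ 4) ^ (n + 1)"
    unfolding n weight_single by (simp only: power_mult[symmetric] mult.commute)
  then show ?thesis
    using cmod_hermite_fun_le[OF assms, of n] unfolding n white_noise_single by simp
next
  case False
  then show ?thesis using weight_pos[of \<alpha>] by (simp add: white_noise_eq_0 less_imp_le)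
qed

lemma continuous_on_wick:
  assumes "\<And>\<alpha>. continuous_on S (\<lambda>z. f z \<alpha>)" "\<And>\<alpha>. continuous_on S (\<lambda>z. g z \<alpha>)"
  shows "continuous_on S (\<lambda>z. (f z \<star> g z) \<alpha>)"
  unfolding wick_def split_def by (intro continuous_intros assms)

text \<open>One extra power of the weight pays for the number of decompositions of \<open>\<alpha>\<close>.\<close>

lemma cmod_wick_le:
  assumes f: "\<And>\<alpha>. cmod (f \<alpha>) \<le> C * weight \<alpha> ^ q"
    and g: "\<And>\<alpha>. cmod (g \<alpha>) \<le> D * weight \<alpha> ^ q"
    and "0 \<le> C" "0 \<le> D"
  shows "cmod ((f \<star> g) \<alpha>) \<le> C * D * exp 2 * weight \<alpha> ^ (q + 1)"
proof -
  let ?P = "{(\<beta>, \<gamma>). \<beta> + \<gamma> = \<alpha>}"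
  \<comment> \<open>By cancellation \<open>\<gamma>\<close> determines \<open>\<beta>\<close>, so
    the sum over decompositions is a sum over distinct multi-indices
    \<open>\<gamma>\<close>.\<close>
  have inj: "inj_on snd ?P" by (auto intro!: inj_onI)
  have "cmod ((f \<star> g) \<alpha>) \<le> (\<Sum>(\<beta>, \<gamma>)\<in>?P. C * D * weight \<alpha> ^ (q + 1) * (1 / weight \<gamma>))"
    unfolding wick_def
  proof (intro sum_norm_le, clarify)
    fix \<beta> \<gamma> :: multi_index assume \<alpha>: "\<alpha> = \<beta> + \<gamma>"
    have pos: "0 < weight \<beta>" "0 < weight \<gamma>" by (rule weight_pos)+
    have "cmod (f \<beta> * g \<gamma>) \<le> (C * weight \<beta> ^ q) * (D * weight \<gamma> ^ q)"
      unfolding norm_mult using f g assms(3) pos by (intro mult_mono) auto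
    also have "\<dots> = C * D * weight (\<beta> + \<gamma>) ^ q * 1"
      by (simp add: weight_add power_mult_distrib)
    \<comment> \<open>The inserted factor equals \<open>weight \<beta>\<close>, which is at least 1,
      and it exposes the summable \<open>1 / weight \<gamma>\<close>.\<close>
    also have "\<dots> \<le> C * D * weight (\<beta> + \<gamma>) ^ q * (weight (\<beta> + \<gamma>) * (1 / weight \<gamma>))"
      using pos assms(3,4) weight_ge_1[of \<beta>] weight_pos[of "\<beta> + \<gamma>"]
      by (intro mult_left_mono) (auto simp: weight_add)
    finally show "cmod (f \<beta> * g \<gamma>) \<le> C * D * weight (\<beta> + \<gamma>) ^ (q + 1) * (1 / weight \<gamma>)"
      by (simp add: algebra_simps)
  qed
  also have "\<dots> = C * D * weight \<alpha> ^ (q + 1) * (\<Sum>\<gamma>\<in>snd ` ?P. 1 / weight \<gamma>)"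
    unfolding sum.reindex[OF inj] by (simp add: split_def sum_distrib_left)
  also have "\<dots> \<le> C * D * weight \<alpha> ^ (q + 1) * exp 2"
    using assms(3,4) weight_pos[of \<alpha>]
    by (intro mult_left_mono sum_inverse_weight_le finite_imageI finite_decompositions)
      (auto simp: less_imp_le)
  finally show ?thesis by (simp add: algebra_simps)
qed

section \<open>The integrand along the path\<close>

theorem theorem7p1:
  fixes R a b :: real
    and f :: "complex \<Rightarrow> family"
    and \<gamma> \<gamma>' :: "real \<Rightarrow> complex"
  assumes "R > 0"
    and "continuous_map (top_of_set (cball 0 R)) Fdist_top f"
    and "a < b"
    and "\<And>t. t \<in> {a..b} \<Longrightarrow> (\<gamma> has_vector_derivative \<gamma>' t) (at t within {a..b})"
    and "continuous_on {a..b} \<gamma>'"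
    and "\<gamma> ` {a..b} \<subseteq> cball 0 R"
  shows "\<exists>p\<ge>1.
      continuous_map (top_of_set {a..b}) (Fneg_top p)
        (\<lambda>t \<alpha>. (f (\<gamma> t) \<star> white_noise (\<gamma> t)) \<alpha> * \<gamma>' t)
    \<and> (\<exists>I. has_Riemann_integral_Fneg p
          (\<lambda>t \<alpha>. (f (\<gamma> t) \<star> white_noise (\<gamma> t)) \<alpha> * \<gamma>' t) I a b)"
proof -
  let ?g = "\<lambda>t \<alpha>. (f (\<gamma> t) \<star> white_noise (\<gamma> t)) \<alpha> * \<gamma>' t"
  have "continuous_on {a..b} \<gamma>"
    using assms(4) has_vector_derivative_continuous continuous_on_eq_continuous_within by blast
  note cont_\<gamma> = continuous_on_compose2[OF _ this assms(6)]
  have cont: "continuous_on {a..b} (\<lambda>t. ?g t \<alpha>)" for \<alpha>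
    by (intro continuous_on_mult continuous_on_wick assms(5)
        cont_\<gamma>[OF continuous_on_Fdist_coordinate[OF assms(2)]] cont_\<gamma>[OF continuous_on_white_noise])
  \<comment> \<open>Compactness of the closed disc enters here: one exponent \<open>q\<close> serves
    all values of \<open>f\<close>.\<close>
  obtain C q where C: "0 \<le> C"
    "\<And>z \<alpha>. z \<in> cball 0 R \<Longrightarrow> cmod (f z \<alpha>) \<le> C * weight \<alpha> ^ q"
    using continuous_map_Fdist_compact_bound[OF compact_cball assms(2)] by blast
  have "bounded (\<gamma>' ` {a..b})"
    using assms(5) by (intro compact_imp_bounded compact_continuous_image) auto
  then obtain L where L: "0 < L" "\<And>t. t \<in> {a..b} \<Longrightarrow> cmod (\<gamma>' t) \<le> L"
    by (auto simp: bounded_pos)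
  \<comment> \<open>A common exponent for the bounds on \<open>f\<close> (power \<open>q\<close>)
    and on the white noise (power 4).\<close>
  define s where "s = max q 4"
  have pow: "weight \<alpha> ^ q \<le> weight \<alpha> ^ s" "weight \<alpha> ^ 4 \<le> weight \<alpha> ^ s" for \<alpha>
    unfolding s_def using weight_ge_1 by (auto intro!: power_increasing)
  \<comment> \<open>The factors bound, in order, \<open>f\<close>, the white noise, the sum over
    decompositions and the velocity of the path.\<close>
  define K where "K = C * exp (4 * R\<^sup>2) * exp 2 * L"
  have bound: "cmod (?g t \<alpha>) \<le> K * weight \<alpha> ^ (s + 1)" if t: "t \<in> {a..b}" for t \<alpha>
  proof -
    have z: "\<gamma> t \<in> cball 0 R" using assms(6) t by blast
    have "cmod ((f (\<gamma> t) \<star> white_noise (\<gamma> t)) \<alpha>)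
        \<le> C * exp (4 * R\<^sup>2) * exp 2 * weight \<alpha> ^ (s + 1)"
    proof (rule cmod_wick_le)
      show "cmod (f (\<gamma> t) \<beta>) \<le> C * weight \<beta> ^ s" for \<beta>
        using C(2)[OF z, of \<beta>] mult_left_mono[OF pow(1)[of \<beta>] C(1)] by linarith
      show "cmod (white_noise (\<gamma> t) \<beta>) \<le> exp (4 * R\<^sup>2) * weight \<beta> ^ s" for \<beta>
        by (rule order_trans[OF cmod_white_noise_le[of _ R] mult_left_mono[OF pow(2)]]) (use z in auto)
    qed (use C in auto)
    then have "cmod (?g t \<alpha>) \<le> (C * exp (4 * R\<^sup>2) * exp 2 * weight \<alpha> ^ (s + 1)) * L"
      unfolding norm_mult using L(2)[OF t] by (intro mult_mono) (auto intro: order_trans[OF norm_ge_zero])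
    then show ?thesis by (simp add: K_def algebra_simps)
  qed
  \<comment> \<open>Squaring the bound produces the power \<open>2 * (s + 1)\<close>; one further
    power leaves \<open>K\<^sup>2 / weight \<alpha>\<close>, which is summable.\<close>
  define p where "p = 2 * (s + 1) + 1"
  have "(K * w ^ (s + 1))\<^sup>2 / w ^ p = K\<^sup>2 * (1 / w)" if "w > 0" for w :: real
  proof -
    have "(K * w ^ (s + 1))\<^sup>2 = K\<^sup>2 * w ^ (2 * (s + 1))"
      by (simp only: power_mult_distrib power_mult[symmetric] mult.commute)
    moreover have "w ^ p = w ^ (2 * (s + 1)) * w" by (simp only: p_def power_add power_one_right)
    ultimately show ?thesis using that by simp
  qed
  then have B: "(\<lambda>\<alpha>. (K * weight \<alpha> ^ (s + 1))\<^sup>2 / weight \<alpha> ^ p) summable_on UNIV"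
    using summable_on_cmult_right[OF summable_inverse_weight, of "K\<^sup>2"]
    by (simp only: weight_pos)
  have "p \<ge> 1" by (simp add: p_def)
  with continuous_map_Fneg_dominated[OF cont bound B]
    has_Riemann_integral_Fneg_dominated[OF less_imp_le[OF assms(3)] cont bound B]
  show ?thesis by blast
qed

end
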